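(* Let $\eta$ be a point process with values in $M_p(\mathcal{R}_0^d)$ such that $$\big(\eta,d(0,\eta)\big)\in\mathrm{RV}\big(M_p(\mathcal{R}_0^d)\times[0,\infty],\,\cdot\,,\mathcal{M}_p^{(1)}(\mathcal{R}_0^d)\times[0,\infty],\,g,\,\mu^*\big).$$ Then $\mathrm{cl}(\mathrm{supp}\,\eta)\in\mathrm{RV}(\mathcal{K}^d,\cdot,\mathfrak{K}_0,g,\tilde\mu)$, where the tail measure $\tilde\mu$ is the pushforward of $\mu^*$ under the map $\psi$ defined in the context.
   Context: An ideal $\mathcal{S}$ on a space $E$ is a family of subsets closed under finite unions and subsets; $U_{\mathcal{S}}$ is its union. For a metrisable space $E$ with scaling $(T_t)_{t>0}$, ideal $\mathcal{S}$, and a random element $\xi$, $\xi\in\mathrm{RV}(E,T,\mathcal{S},g,\mu)$ means: $g:[0,\infty)\to[0,\infty)$ is measurable with $g(t)\to\infty$; $\mu$ (tail measure) is a Borel measure finite on Borel sets in $\mathcal{S}$, vanishing outside $U_{\mathcal{S}}$, with $\mu(B)>0$ for some $B\in\mathcal{S}$; and $g(t)\mathbf{E}f(T_{t^{-1}}\xi)\to\int f\,d\mu$ as $t\to\infty$ for all bounded continuous $f:U_{\mathcal{S}}\to\mathbb{R}$ with support (closure in $E$ of $\{f\ne0\}$) in $\mathcal{S}$. Linear scaling is denoted by $\cdot$. $\mathcal{R}_0^d=\{A\subset\mathbb{R}^d:\inf_{x\in A}\|x\|>0\}$. $M_p(\mathcal{R}_0^d)$ is the set of counting (integer-valued) Borel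 measures $m$ on $\mathbb{R}^d\setminus\{0\}$ which are finite on sets from $\mathcal{R}_0^d$, with the vague topology (generated by $m\mapsto\int f\,dm$ for bounded continuous $f$ with support in $\mathcal{R}_0^d$) and the scaling $(T_tm)(A)=m(t^{-1}A)$. $\mathcal{M}_p^{(1)}(\mathcal{R}_0^d)$ is the ideal of all $D\subset M_p(\mathcal{R}_0^d)$ for which there is a Borel $A\in\mathcal{R}_0^d$ with $m(A)\ge1$ for all $m\in D$. The product space $M_p(\mathcal{R}_0^d)\times[0,\infty]$ has the product topology, scaling $T_t(m,r)=(T_tm,tr)$ ($t\infty=\infty$), and the ideal $\mathcal{M}_p^{(1)}(\mathcal{R}_0^d)\times[0,\infty]$ generated by the sets $D\times[0,\infty]$, $D\in\mathcal{M}_p^{(1)}(\mathcal{R}_0^d)$. $\mathrm{supp}\,m$ is the set of atoms of $m$; $d(0,m)=\inf\{\|x\|:x\in\mathrm{supp}\,m\}$, with $d(0,m)=\infty$ if $m=0$. Let $M'=\{(m,r)\in M_p(\mathcal{R}_0^d)\times[0,\infty): r=d(0,m)\text{ or }r=0\}\cup\{(0,\infty)\}$. The map $\psi:M'\to\mathcal{K}^d$ is $\psi(m,r)=\mathrm{cl}(\mathrm{supp}\,m)$ if $m\neq0$, $r>0$; $\psi(m,0)=\mathrm{cl}(\mathrm{supp}\,m)\cup\{0\}$ if $m\ne0$; $\psi(0,0)=\{0\}$; $\psi(0,\infty)=\emptyset$. ($\mu^*$ is supported on $M'$, which is closed.) $\mathcal{K}^d$ is the family of compact subsets of $\mathbb{R}^d$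 with the Hausdorff metric (the distance from a non-empty set to $\emptyset$ being infinite) and linear scaling $T_tK=tK$. $\mathfrak{K}_0$ is the ideal of all families $\mathcal{A}\subset\mathcal{K}^d$ with $\inf_{K\in\mathcal{A}}\|K\|>0$, where $\|K\|=\sup_{x\in K}\|x\|$ and $\|\emptyset\|=0$. *)

theory Defs
  imports "HOL-Probability.Probability"
begin

definition borel_of :: "'e topology \<Rightarrow> 'e measure" where
  "borel_of E = sigma (topspace E) {U. openin E U}"

definition random_element :: "'w measure \<Rightarrow> 'e topology \<Rightarrow> ('w \<Rightarrow> 'e) \<Rightarrow> bool" where
  "random_element P E \<xi> \<longleftrightarrow> prob_space P \<and> \<xi> \<in> P \<rightarrow>\<^sub>M borel_of E"

definition ideal_on :: "'e set \<Rightarrow> 'e set set \<Rightarrow> bool" where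
  "ideal_on X \<S> \<longleftrightarrow> \<S> \<subseteq> Pow X \<and> {} \<in> \<S> \<and>
     (\<forall>A\<in>\<S>. \<forall>B\<in>\<S>. A \<union> B \<in> \<S>) \<and> (\<forall>A\<in>\<S>. \<forall>B. B \<subseteq> A \<longrightarrow> B \<in> \<S>)"

text \<open>A scaling is a jointly continuous action of the multiplicative group \<open>(0,\<infinity>)\<close>;
  the values of \<open>T t\<close> for \<open>t \<le> 0\<close> are irrelevant.\<close>

definition scaling_on :: "'e topology \<Rightarrow> (real \<Rightarrow> 'e \<Rightarrow> 'e) \<Rightarrow> bool" where
  "scaling_on E T \<longleftrightarrow>
     (\<forall>x\<in>topspace E. T 1 x = x) \<and>
     (\<forall>s>0. \<forall>t>0. \<forall>x\<in>topspace E. T s (T t x) = T (s * t) x) \<and>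
     continuous_map (prod_topology (top_of_set {0<..}) E) E (\<lambda>(t, x). T t x)"

text \<open>Test functions live on \<open>\<Union>\<S>\<close> only; under the integrals they are extended by \<open>0\<close>.\<close>

definition test_fun :: "'e topology \<Rightarrow> 'e set set \<Rightarrow> ('e \<Rightarrow> real) \<Rightarrow> bool" where
  "test_fun E \<S> f \<longleftrightarrow>
     continuous_map (subtopology E (\<Union>\<S>)) euclideanreal f \<and> bounded (f ` \<Union>\<S>) \<and>
     E closure_of {x \<in> \<Union>\<S>. f x \<noteq> 0} \<in> \<S>"

definition RV :: "'w measure \<Rightarrow> 'e topology \<Rightarrow> (real \<Rightarrow> 'e \<Rightarrow> 'e) \<Rightarrow> 'e set set \<Rightarrow>
    (real \<Rightarrow> real) \<Rightarrow> 'e measure \<Rightarrow> ('w \<Rightarrow> 'e) \<Rightarrow> bool" where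
  "RV P E T \<S> g \<mu> \<xi> \<longleftrightarrow>
     metrizable_space E \<and> scaling_on E T \<and> ideal_on (topspace E) \<S> \<and> random_element P E \<xi> \<and>
     (g \<in> borel_measurable (restrict_space borel {0..}) \<and> (\<forall>t\<ge>0. g t \<ge> 0) \<and>
        filterlim g at_top at_top) \<and>
     (sets \<mu> = sets (borel_of E) \<and>
        (\<forall>B \<in> sets \<mu> \<inter> \<S>. emeasure \<mu> B < \<infinity>) \<and>
        (\<forall>B \<in> sets \<mu>. B \<inter> \<Union>\<S> = {} \<longrightarrow> emeasure \<mu> B = 0) \<and>
        (\<exists>B \<in> sets \<mu> \<inter> \<S>. emeasure \<mu> B > 0)) \<and>
     (\<forall>f. test_fun E \<S> f \<longrightarrow>
        ((\<lambda>t. g t * (\<integral>\<omega>. indicator (\<Union>\<S>) (T (inverse t) (\<xi> \<omega>)) * f (T (inverse t) (\<xi> \<omega>)) \<partial>P))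
           \<longlongrightarrow> (\<integral>x. indicator (\<Union>\<S>) x * f x \<partial>\<mu>)) at_top)"

text \<open>With values in \<^typ>\<open>ennreal\<close>, infima over the empty set are \<open>\<infinity>\<close> and suprema are \<open>0\<close>;
  these are the intended conventions in all definitions below.\<close>

definition R0 :: "'a::euclidean_space set set" where
  "R0 = {A. (INF x\<in>A. ennreal (norm x)) > 0}"

definition punctured_borel :: "'a::euclidean_space measure" where
  "punctured_borel = restrict_space borel (- {0})"

definition Mp :: "'a::euclidean_space measure set" where
  "Mp = {m. sets m = sets punctured_borel \<and>
     (\<forall>A\<in>sets m. emeasure m A = \<infinity> \<or> (\<exists>n::nat. emeasure m A = of_nat n)) \<and>
     (\<forall>A\<in>sets m. A \<in> R0 \<longrightarrow> emeasure m A < \<infinity>)}"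

definition vague_test_fun :: "('a::euclidean_space \<Rightarrow> real) \<Rightarrow> bool" where
  "vague_test_fun f \<longleftrightarrow> continuous_on (- {0}) f \<and> bounded (f ` (- {0})) \<and>
     closure {x. x \<noteq> 0 \<and> f x \<noteq> 0} \<in> R0"

definition vague_topology :: "'a::euclidean_space measure topology" where
  "vague_topology = topology_generated_by
     {{m \<in> Mp. (\<integral>x. f x \<partial>m) \<in> U} | f U. vague_test_fun f \<and> open U}"

definition dilate_measure :: "real \<Rightarrow> 'a::euclidean_space measure \<Rightarrow> 'a measure" where
  "dilate_measure t m = distr m punctured_borel (\<lambda>x. t *\<^sub>R x)"

definition Mp1 :: "'a::euclidean_space measure set set" where
  "Mp1 = {D. D \<subseteq> Mp \<and> (\<exists>A\<in>sets borel. A \<in> R0 \<and> (\<forall>m\<in>D. emeasure m A \<ge> 1))}"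

definition atoms :: "'a::euclidean_space measure \<Rightarrow> 'a set" where
  "atoms m = {x \<in> space m. emeasure m {x} > 0}"

definition dist0 :: "'a::euclidean_space measure \<Rightarrow> ennreal" where
  "dist0 m = (INF x\<in>atoms m. ennreal (norm x))"

definition MpR_top :: "('a::euclidean_space measure \<times> ennreal) topology" where
  "MpR_top = prod_topology vague_topology euclidean"

definition dilate_MpR :: "real \<Rightarrow> 'a::euclidean_space measure \<times> ennreal \<Rightarrow> 'a measure \<times> ennreal" where
  "dilate_MpR t = (\<lambda>(m, r). (dilate_measure t m, ennreal t * r))"

definition Mp1R :: "('a::euclidean_space measure \<times> ennreal) set set" where
  "Mp1R = {C. \<exists>D\<in>Mp1. C \<subseteq> D \<times> UNIV}"

definition hausdorff_dist :: "'a::euclidean_space set \<Rightarrow> 'a set \<Rightarrow> ennreal" where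
  "hausdorff_dist K L =
     max (SUP x\<in>K. INF y\<in>L. ennreal (dist x y)) (SUP y\<in>L. INF x\<in>K. ennreal (dist x y))"

definition Kd_top :: "'a::euclidean_space set topology" where
  "Kd_top = topology_generated_by
     {{L. compact L \<and> hausdorff_dist K L < e} | K e. compact K \<and> e > 0}"

definition set_norm :: "'a::euclidean_space set \<Rightarrow> ennreal" where
  "set_norm K = (SUP x\<in>K. ennreal (norm x))"

definition K0 :: "'a::euclidean_space set set set" where
  "K0 = {\<A>. \<A> \<subseteq> {K. compact K} \<and> (INF K\<in>\<A>. set_norm K) > 0}"

definition dilate_set :: "real \<Rightarrow> 'a::euclidean_space set \<Rightarrow> 'a set" where
  "dilate_set t K = (\<lambda>x. t *\<^sub>R x) ` K"

definition zero_measure :: "'a::euclidean_space measure" where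
  "zero_measure = null_measure punctured_borel"

definition M' :: "('a::euclidean_space measure \<times> ennreal) set" where
  "M' = {(m, r). m \<in> Mp \<and> r < \<infinity> \<and> (r = dist0 m \<or> r = 0)} \<union> {(zero_measure, \<infinity>)}"

text \<open>Only the values on \<^const>\<open>M'\<close> matter, where \<open>m = 0\<close> forces \<open>r = 0\<close> or \<open>r = \<infinity>\<close>.\<close>

definition psi :: "'a::euclidean_space measure \<times> ennreal \<Rightarrow> 'a set" where
  "psi = (\<lambda>(m, r).
     if m \<noteq> zero_measure then
       (if r > 0 then closure (atoms m) else closure (atoms m) \<union> {0})
     else (if r = 0 then {0} else {}))"

text \<open>As \<^const>\<open>psi\<close> is a map on \<^const>\<open>M'\<close>, the measure is restricted to
  \<^const>\<open>M'\<close> before it is pushed forward.\<close>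

definition psi_pushforward ::
    "('a::euclidean_space measure \<times> ennreal) measure \<Rightarrow> 'a set measure" where
  "psi_pushforward \<mu> = distr (restrict_space \<mu> M') (borel_of Kd_top) psi"

end

theory Submission
  imports Defs
begin

text \<open>
  The statement is an instance of the continuous mapping principle. Write \<open>X\<close> for the pair
  \<open>(\<eta>, dist0 \<eta>)\<close>. It always lies in the set \<^const>\<open>M'\<close>, which is closed and invariant under
  scaling, and \<open>psi X\<close> is the closed support of \<open>\<eta>\<close> (lemma \<open>psi_dist0\<close>). On \<^const>\<open>M'\<close> the map
  \<^const>\<open>psi\<close> is continuous, commutes with scaling, and pulls the ideal \<^const>\<open>K0\<close> back into the
  ideal \<^const>\<open>Mp1R\<close>: a compact set with a point of norm at least \<open>\<delta>\<close> can only come from a point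
  measure with an atom of norm at least \<open>\<delta>\<close>. This is all that regular variation needs in order
  to be transported, as \<open>RV_continuous_image\<close> shows in an abstract setting.

  There, a test function \<open>f\<close> on the target gives \<open>f \<circ> psi\<close> on the closed set \<^const>\<open>M'\<close> only. The
  Tietze theorem extends it to the union of the ideal, and a cutoff function makes the support of
  the extension a member of the ideal without changing it on \<^const>\<open>M'\<close>. The assumed
  convergence for this test function is the desired one for \<open>f\<close>, because the scaled random
  element never leaves \<^const>\<open>M'\<close>; for the same reason the tail measure vanishes off \<^const>\<open>M'\<close>
  (\<open>RV_tail_measure_outside_closed\<close>).

  Continuity of \<^const>\<open>psi\<close> is where the second coordinate matters. The Hausdorff topology is
  controlled by the conditions that a compact set hits an open set \<open>G\<close> or misses a closed set
  \<open>C\<close> (\<open>continuous_map_Kd_top_hit_miss\<close>). In the vague topology ``some atom lies in \<open>G\<close>''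
  is an open condition, and so is ``no atom lies in \<open>C\<close>'' as long as \<open>C\<close> stays away from the
  origin (\<open>openin_vague_hit\<close>, \<open>openin_vague_miss\<close>), but nothing is controlled near the origin,
  where atoms may accumulate or escape. On \<^const>\<open>M'\<close> the coordinate \<open>r\<close> supplies what is missing:
  \<open>r > \<delta>\<close> says that all atoms have norm above \<open>\<delta>\<close>, and \<open>r < \<epsilon>\<close> says that \<open>psi\<close> contains the
  origin or a point of norm below \<open>\<epsilon>\<close>.
\<close>

section \<open>Continuous mapping theorem for regular variation\<close>

lemma space_borel_of [simp]: "space (borel_of E) = topspace E"
  unfolding borel_of_def by (rule space_measure_of) (auto dest: openin_subset)

lemma openin_imp_borel_of: "openin E U \<Longrightarrow> U \<in> sets (borel_of E)"
  unfolding borel_of_def by (subst sets_measure_of) (auto dest: openin_subset)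

lemma closedin_imp_borel_of: "closedin E C \<Longrightarrow> C \<in> sets (borel_of E)"
  using sets.compl_sets[OF openin_imp_borel_of[of E "topspace E - C"]]
  by (simp add: closedin_def double_diff)

lemma measurable_borel_ofI:
  assumes "\<And>x. x \<in> space M \<Longrightarrow> f x \<in> topspace E"
    and "\<And>U. openin E U \<Longrightarrow> f -` U \<inter> space M \<in> sets M"
  shows "f \<in> M \<rightarrow>\<^sub>M borel_of E"
  unfolding borel_of_def
  by (rule measurable_measure_of) (use assms in \<open>auto dest: openin_subset\<close>)

lemma continuous_map_borel_of_restrict:
  assumes "continuous_map (subtopology E F) E' \<psi>"
  shows "\<psi> \<in> restrict_space (borel_of E) F \<rightarrow>\<^sub>M borel_of E'"
proof (rule measurable_borel_ofI)
  fix x assume "x \<in> space (restrict_space (borel_of E) F)"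
  then show "\<psi> x \<in> topspace E'"
    using continuous_map_image_subset_topspace[OF assms] by (auto simp: space_restrict_space)
next
  fix U assume "openin E' U"
  from openin_continuous_map_preimage[OF assms this]
  obtain T where T: "openin E T" "{x \<in> topspace E \<inter> F. \<psi> x \<in> U} = T \<inter> F"
    by (auto simp: openin_subtopology)
  then have "\<psi> -` U \<inter> space (restrict_space (borel_of E) F) = F \<inter> T"
    by (auto simp: space_restrict_space)
  then show "\<psi> -` U \<inter> space (restrict_space (borel_of E) F) \<in> sets (restrict_space (borel_of E) F)"
    using openin_imp_borel_of[OF T(1)] by (auto simp: sets_restrict_space)
qed

text \<open>
  Test functions are continuous only on the open union of the ideal, so their extension by zero
  need not be continuous, but it is Borel.
\<close>

lemma borel_measurable_indicator_times:
  assumes "openin E U" "continuous_map (subtopology E U) euclideanreal f"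
  shows "(\<lambda>x. indicator U x * f x) \<in> borel_measurable (borel_of E)"
proof (rule borel_measurableI)
  fix S :: "real set" assume "open S"
  have "openin (subtopology E U) {x \<in> topspace (subtopology E U). f x \<in> S}"
    using assms(2) \<open>open S\<close> by (intro openin_continuous_map_preimage[of _ euclideanreal]) auto
  then have "openin E {x \<in> U. f x \<in> S}"
    using openin_subset[OF assms(1)] openin_trans_full[OF _ assms(1)]
    by (simp add: Int_absorb1 Int_absorb2)
  moreover have "(\<lambda>x. indicator U x * f x) -` S \<inter> space (borel_of E) =
      {x \<in> U. f x \<in> S} \<union> (if 0 \<in> S then topspace E - U else {})"
    using openin_subset[OF assms(1)] by (auto simp: indicator_def of_bool_def split: if_splits)
  ultimately show "(\<lambda>x. indicator U x * f x) -` S \<inter> space (borel_of E) \<in> sets (borel_of E)"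
    using openin_imp_borel_of[of E] sets.compl_sets[OF openin_imp_borel_of[OF assms(1)]]
    by (auto intro!: sets.Un)
qed

text \<open>
  Members of the ideal are separated from the outside of the ideal by continuous functions. This
  is what makes the class of test functions rich: it is a form of the topological consistency of
  an ideal.
\<close>

definition ideal_cutoffs :: "'e topology \<Rightarrow> 'e set set \<Rightarrow> bool" where
  "ideal_cutoffs E \<S> \<longleftrightarrow> (\<forall>B\<in>\<S>. \<exists>c. continuous_map E euclideanreal c \<and> (\<forall>x. 0 \<le> c x \<and> c x \<le> 1) \<and>
     (\<forall>x\<in>B. c x = 1) \<and> E closure_of {x \<in> topspace E. c x \<noteq> 0} \<in> \<S>)"

lemma ideal_cutoffsE:
  assumes "ideal_cutoffs E \<S>" "B \<in> \<S>"
  obtains c where "continuous_map E euclideanreal c" "\<And>x. 0 \<le> c x" "\<And>x. c x \<le> 1"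
    "\<And>x. x \<in> B \<Longrightarrow> c x = 1" "E closure_of {x \<in> topspace E. c x \<noteq> 0} \<in> \<S>"
  using bspec[OF assms(1)[unfolded ideal_cutoffs_def] assms(2)] that by (elim exE conjE) metis

lemma ideal_on_subset: "ideal_on X \<S> \<Longrightarrow> A \<in> \<S> \<Longrightarrow> B \<subseteq> A \<Longrightarrow> B \<in> \<S>"
  by (simp add: ideal_on_def)

lemma ideal_on_Union_subset: "ideal_on X \<S> \<Longrightarrow> \<Union>\<S> \<subseteq> X"
  by (rule Union_least) (auto simp: ideal_on_def)

text \<open>
  Around a point of a member \<open>B\<close>, the set where the cutoff of \<open>B\<close> is
  nonzero is an open neighbourhood inside a member.
\<close>

lemma ideal_cutoffs_openin_Union:
  assumes id: "ideal_on (topspace E) \<S>" and cut: "ideal_cutoffs E \<S>"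
  shows "openin E (\<Union>\<S>)"
proof (subst openin_subopen, intro ballI)
  fix x assume "x \<in> \<Union>\<S>"
  then obtain B where B: "x \<in> B" "B \<in> \<S>" by blast
  from cut B(2) obtain c where c: "continuous_map E euclideanreal c" 
    "\<And>x. x \<in> B \<Longrightarrow> c x = 1" "E closure_of {x \<in> topspace E. c x \<noteq> 0} \<in> \<S>"
    by (rule ideal_cutoffsE) blast
  have "openin E {x \<in> topspace E. c x \<in> - {0}}"
    by (rule openin_continuous_map_preimage[OF c(1)]) (simp add: open_Compl)
  moreover have "x \<in> topspace E" using ideal_on_Union_subset[OF id] B by blast
  moreover have "{x \<in> topspace E. c x \<in> - {0}} \<subseteq> \<Union>\<S>"
    using c(3) closure_of_subset[of "{x \<in> topspace E. c x \<noteq> 0}" E] by fastforce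
  ultimately show "\<exists>T. openin E T \<and> x \<in> T \<and> T \<subseteq> \<Union>\<S>"
    using c(2)[OF B(1)] by (intro exI[of _ "{x \<in> topspace E. c x \<in> - {0}}"]) auto
qed

text \<open>
  Multiplying by a cutoff turns a bounded continuous function on the union of the ideal into a
  test function, since the support can only shrink.
\<close>

lemma cutoff_times_test_fun:
  assumes id: "ideal_on (topspace E) \<S>"
    and c: "continuous_map E euclideanreal c" "\<And>x. 0 \<le> c x" "\<And>x. c x \<le> 1"
      "E closure_of {x \<in> topspace E. c x \<noteq> 0} \<in> \<S>"
    and h: "continuous_map (subtopology E (\<Union>\<S>)) euclideanreal h" "\<And>x. x \<in> \<Union>\<S> \<Longrightarrow> \<bar>h x\<bar> \<le> b"
  shows "test_fun E \<S> (\<lambda>x. c x * h x)"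
  unfolding test_fun_def
proof (intro conjI)
  show "continuous_map (subtopology E (\<Union>\<S>)) euclideanreal (\<lambda>x. c x * h x)"
    by (intro continuous_map_real_mult continuous_map_from_subtopology c h)
  show "bounded ((\<lambda>x. c x * h x) ` \<Union>\<S>)"
    unfolding bounded_iff
  proof (intro exI ballI)
    fix y assume "y \<in> (\<lambda>x. c x * h x) ` \<Union>\<S>"
    then obtain x where "x \<in> \<Union>\<S>" "y = c x * h x" by blast
    have "c x * \<bar>h x\<bar> \<le> 1 * b"
      using c(2,3) h(2)[OF \<open>x \<in> \<Union>\<S>\<close>] by (intro mult_mono) auto
    then show "norm y \<le> b" using c(2)[of x] \<open>y = c x * h x\<close> by (simp add: abs_mult)
  qed
  have "\<Union>\<S> \<subseteq> topspace E" using id by (rule ideal_on_Union_subset)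
  then show "E closure_of {x \<in> \<Union>\<S>. c x * h x \<noteq> 0} \<in> \<S>"
    by (intro ideal_on_subset[OF id c(4)] closure_of_mono) auto
qed

text \<open>
  If the scaled random element never leaves a closed set \<open>F\<close>, then test functions
  vanishing on \<open>F\<close> have prelimit expectations zero, and hence integral zero under the
  tail measure. The complement of \<open>F\<close> is a countable union of closed sets \<open>K
  j\<close>, each separated from \<open>F\<close> by an Urysohn function; its product with a
  cutoff for \<open>A n\<close> is a test function equal to 1 on \<open>K j\<close> intersected
  with \<open>A n\<close>.
\<close>

lemma RV_tail_measure_outside_closed:
  assumes RV: "RV P E T \<S> g \<mu> \<xi>" and F: "closedin E F"
    and Tin: "\<And>t \<omega>. t > 0 \<Longrightarrow> \<omega> \<in> space P \<Longrightarrow> T t (\<xi> \<omega>) \<in> F"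
    and cut: "ideal_cutoffs E \<S>"
    and cover: "\<And>n::nat. A n \<in> \<S>" "\<Union>\<S> \<subseteq> (\<Union>n. A n)"
  shows "emeasure \<mu> (topspace E - F) = 0"
proof -
  note R = RV[unfolded RV_def]
  from R have met: "metrizable_space E" and id: "ideal_on (topspace E) \<S>"
    and smu: "sets \<mu> = sets (borel_of E)"
    and fin: "\<And>B. B \<in> sets \<mu> \<Longrightarrow> B \<in> \<S> \<Longrightarrow> emeasure \<mu> B < \<infinity>"
    and out: "\<And>B. B \<in> sets \<mu> \<Longrightarrow> B \<inter> \<Union>\<S> = {} \<Longrightarrow> emeasure \<mu> B = 0"
    and lim: "\<And>f. test_fun E \<S> f \<Longrightarrow>
      ((\<lambda>t. g t * (\<integral>\<omega>. indicator (\<Union>\<S>) (T (inverse t) (\<xi> \<omega>)) * f (T (inverse t) (\<xi> \<omega>)) \<partial>P))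
           \<longlongrightarrow> (\<integral>x. indicator (\<Union>\<S>) x * f x \<partial>\<mu>)) at_top"
    by auto
  have spm: "space \<mu> = topspace E" using sets_eq_imp_space_eq[OF smu] by simp
  have opU: "openin E (\<Union>\<S>)" by (rule ideal_cutoffs_openin_Union[OF id cut])
  have normal: "normal_space E" using met by (rule metrizable_imp_normal_space)
  from open_imp_fsigma_in[OF met, of "topspace E - F"] F
  have "fsigma_in E (topspace E - F)" by (simp add: closedin_def)
  then obtain K where K: "\<And>n::nat. closedin E (K n)" "(\<Union>n. K n) = topspace E - F"
    unfolding fsigma_in_ascending by blast
  have "\<exists>c. continuous_map E euclideanreal c \<and> (\<forall>x. 0 \<le> c x \<and> c x \<le> 1) \<and>
     (\<forall>x\<in>A n. c x = 1) \<and> E closure_of {x \<in> topspace E. c x \<noteq> 0} \<in> \<S>" for n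
    using cut cover(1)[of n] unfolding ideal_cutoffs_def by blast
  then obtain c where c: "\<And>n. continuous_map E euclideanreal (c n)" "\<And>n x. 0 \<le> c n x" "\<And>n x. c n x \<le> 1"
    "\<And>n x. x \<in> A n \<Longrightarrow> c n x = 1" "\<And>n. E closure_of {x \<in> topspace E. c n x \<noteq> 0} \<in> \<S>"
    by metis
  \<comment> \<open>The sets A n need not be Borel, so they are replaced by closed sets containing them.\<close>
  define D where "D n = {x \<in> topspace E. c n x \<in> {1}}" for n
  have D_closed: "closedin E (D n)" for n
    unfolding D_def by (rule closedin_continuous_map_preimage[OF c(1)]) simp
  have null: "emeasure \<mu> (K j \<inter> D n) = 0" for j n
  proof -
    have "disjnt F (K j)" using K(2) by (auto simp: disjnt_def)
    then obtain u where u: "continuous_map E (top_of_set {0..1}) u" "u ` F \<subseteq> {0::real}" "u ` K j \<subseteq> {1}"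
      using Urysohn_lemma[OF normal F K(1), of j 0 1] by auto
    have u': "continuous_map E euclideanreal u" and u01: "\<And>x. x \<in> topspace E \<Longrightarrow> 0 \<le> u x \<and> u x \<le> 1"
      using u(1) by (auto simp: continuous_map_in_subtopology Pi_iff)
    let ?f = "\<lambda>x. c n x * u x"
    have US: "\<Union>\<S> \<subseteq> topspace E" using id by (rule ideal_on_Union_subset)
    have "test_fun E \<S> ?f"
      by (rule cutoff_times_test_fun[where b=1, OF id c(1) c(2) c(3) c(5)])
        (use u01 US in \<open>auto intro: continuous_map_from_subtopology u'\<close>)
    from lim[OF this]
    have L: "((\<lambda>t. g t * (\<integral>\<omega>. indicator (\<Union>\<S>) (T (inverse t) (\<xi> \<omega>)) * ?f (T (inverse t) (\<xi> \<omega>)) \<partial>P))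
           \<longlongrightarrow> (\<integral>x. indicator (\<Union>\<S>) x * ?f x \<partial>\<mu>)) at_top" .
    have "\<forall>\<^sub>F t in at_top. g t * (\<integral>\<omega>. indicator (\<Union>\<S>) (T (inverse t) (\<xi> \<omega>)) * ?f (T (inverse t) (\<xi> \<omega>)) \<partial>P) = 0"
      using eventually_gt_at_top[of 0]
    proof eventually_elim
      case (elim t)
      have "u (T (inverse t) (\<xi> \<omega>)) = 0" if "\<omega> \<in> space P" for \<omega>
        using Tin[of "inverse t" \<omega>] that elim u(2) by auto
      then have "(\<integral>\<omega>. indicator (\<Union>\<S>) (T (inverse t) (\<xi> \<omega>)) * ?f (T (inverse t) (\<xi> \<omega>)) \<partial>P) = (\<integral>\<omega>. 0 \<partial>P)"
        by (intro Bochner_Integration.integral_cong) auto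
      then show ?case by simp
    qed
    with L have "((\<lambda>t::real. 0) \<longlongrightarrow> (\<integral>x. indicator (\<Union>\<S>) x * ?f x \<partial>\<mu>)) at_top"
      by (rule Lim_transform_eventually)
    then have int0: "(\<integral>x. indicator (\<Union>\<S>) x * ?f x \<partial>\<mu>) = 0"
      by (simp add: tendsto_const_iff)
    let ?Z = "E closure_of {x \<in> topspace E. c n x \<noteq> 0}"
    have Z: "?Z \<in> sets \<mu>" "emeasure \<mu> ?Z < \<infinity>"
      using fin[OF _ c(5)[of n]] by (auto simp: smu closedin_imp_borel_of)
    have meas: "(\<lambda>x. indicator (\<Union>\<S>) x * ?f x) \<in> borel_measurable \<mu>"
      unfolding measurable_cong_sets[OF smu refl]
      by (intro borel_measurable_indicator_times opU continuous_map_from_subtopology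
          continuous_map_real_mult c(1) u')
    have "integrable \<mu> (\<lambda>x. indicator (\<Union>\<S>) x * ?f x)"
    proof (rule Bochner_Integration.integrable_bound[where f="indicator ?Z :: _ \<Rightarrow> real"])
      show "integrable \<mu> (indicator ?Z :: _ \<Rightarrow> real)" using Z by auto
      show "AE x in \<mu>. norm (indicator (\<Union>\<S>) x * ?f x) \<le> norm (indicator ?Z x :: real)"
      proof (intro AE_I2)
        fix x assume "x \<in> space \<mu>"
        then have x: "x \<in> topspace E" by (simp add: spm)
        have "c n x = 0 \<or> x \<in> ?Z"
          using closure_of_subset[of "{x \<in> topspace E. c n x \<noteq> 0}" E] x by blast
        then show "norm (indicator (\<Union>\<S>) x * ?f x) \<le> norm (indicator ?Z x :: real)"
          using u01[OF x] c(2,3)[of n x]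
          by (auto simp: indicator_def abs_mult intro: mult_le_one)
      qed
    qed (rule meas)
    moreover have "AE x in \<mu>. 0 \<le> indicator (\<Union>\<S>) x * ?f x"
      using u01 c(2) by (intro AE_I2) (simp add: spm)
    ultimately have "AE x in \<mu>. indicator (\<Union>\<S>) x * ?f x = 0"
      using integral_nonneg_eq_0_iff_AE int0 by blast
    moreover have "indicator (\<Union>\<S>) x * ?f x \<noteq> 0" if "x \<in> K j \<inter> D n" for x
    proof -
      have x: "x \<in> topspace E" "c n x = 1" "u x = 1" using that u(3) by (auto simp: D_def)
      then have "x \<in> \<Union>\<S>"
        using closure_of_subset[of "{x \<in> topspace E. c n x \<noteq> 0}" E] c(5)[of n] by fastforce
      with x show ?thesis by simp
    qed
    ultimately have "AE x in \<mu>. x \<notin> K j \<inter> D n" by auto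
    moreover have "K j \<inter> D n \<in> sets \<mu>"
      using K(1) D_closed by (auto simp: smu intro!: closedin_imp_borel_of)
    ultimately have "K j \<inter> D n \<in> null_sets \<mu>" using AE_iff_null_sets by blast
    then show ?thesis by auto
  qed
  have KD: "K j \<inter> D n \<in> sets \<mu>" for j n
    using K(1) D_closed by (auto simp: smu intro!: closedin_imp_borel_of)
  have cov: "topspace E - F \<subseteq> (topspace E - \<Union>\<S>) \<union> (\<Union>j. \<Union>n. K j \<inter> D n)"
  proof
    fix x assume x: "x \<in> topspace E - F"
    then obtain j where "x \<in> K j" using K(2) by auto
    moreover have "\<exists>n. x \<in> D n" if "x \<in> \<Union>\<S>"
      using that cover(2) x c(4) by (force simp: D_def)
    ultimately show "x \<in> (topspace E - \<Union>\<S>) \<union> (\<Union>j. \<Union>n. K j \<inter> D n)" using x by blast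
  qed
  have UU: "\<Union>\<S> \<in> sets \<mu>" unfolding smu by (rule openin_imp_borel_of[OF opU])
  have compl: "topspace E - \<Union>\<S> \<in> null_sets \<mu>"
    using out[of "topspace E - \<Union>\<S>"] sets.compl_sets[OF UU] spm by (auto intro!: null_setsI)
  have "(\<Union>j. \<Union>n. K j \<inter> D n) \<in> null_sets \<mu>"
    by (intro null_sets_UN) (auto intro!: null_setsI null KD)
  with compl have "(topspace E - \<Union>\<S>) \<union> (\<Union>j. \<Union>n. K j \<inter> D n) \<in> null_sets \<mu>" by (rule null_sets.Un)
  moreover have "topspace E - F \<in> sets \<mu>"
    using F unfolding smu by (auto simp: closedin_def intro: openin_imp_borel_of)
  ultimately have "topspace E - F \<in> null_sets \<mu>" using cov by (rule null_sets_subset)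
  then show ?thesis by auto
qed

text \<open>
  The continuous mapping theorem. The map \<open>\<psi>\<close> is only given on a closed
  invariant set \<open>F\<close> that carries the random element. Test functions of the target are
  pulled back to \<open>F\<close>, extended by the Tietze theorem and multiplied by a cutoff that
  is 1 on the preimage of their support. The cover of the source ideal shows that the tail measure
  is carried by \<open>F\<close>; the cover of the target ideal shows that the image measure
  charges one of its members.
\<close>

theorem RV_continuous_image:
  assumes RV: "RV P E T \<S> g \<mu> \<xi>"
    and F: "closedin E F" and xi: "\<And>\<omega>. \<omega> \<in> space P \<Longrightarrow> \<xi> \<omega> \<in> F"
    and TF: "\<And>t x. t > 0 \<Longrightarrow> x \<in> F \<Longrightarrow> T t x \<in> F"
    and cut: "ideal_cutoffs E \<S>"
    and cover: "\<And>n::nat. A n \<in> \<S>" "\<Union>\<S> \<subseteq> (\<Union>n. A n)"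
    and E': "metrizable_space E'" "scaling_on E' T'" "ideal_on (topspace E') \<S>'"
    and cover': "\<And>n::nat. openin E' (B n)" "\<And>n. B n \<in> \<S>'" "\<Union>\<S>' \<subseteq> (\<Union>n. B n)"
    and \<psi>: "continuous_map (subtopology E F) E' \<psi>"
      "\<And>t x. t > 0 \<Longrightarrow> x \<in> F \<Longrightarrow> \<psi> (T t x) = T' t (\<psi> x)"
    and pull: "\<And>B. B \<in> \<S>' \<Longrightarrow> {x \<in> F. \<psi> x \<in> B} \<in> \<S>"
    and push: "\<And>x. x \<in> F \<Longrightarrow> x \<in> \<Union>\<S> \<Longrightarrow> \<psi> x \<in> \<Union>\<S>'"
  shows "RV P E' T' \<S>' g (distr (restrict_space \<mu> F) (borel_of E') \<psi>) (\<lambda>\<omega>. \<psi> (\<xi> \<omega>))"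
proof -
  note R = RV[unfolded RV_def]
  from R have met: "metrizable_space E" and id: "ideal_on (topspace E) \<S>"
    and gg: "g \<in> borel_measurable (restrict_space borel {0..})" "\<forall>t\<ge>0. g t \<ge> 0"
      "filterlim g at_top at_top"
    and re: "random_element P E \<xi>"
    and smu: "sets \<mu> = sets (borel_of E)"
    and fin: "\<And>B. B \<in> sets \<mu> \<Longrightarrow> B \<in> \<S> \<Longrightarrow> emeasure \<mu> B < \<infinity>"
    and out: "\<And>B. B \<in> sets \<mu> \<Longrightarrow> B \<inter> \<Union>\<S> = {} \<Longrightarrow> emeasure \<mu> B = 0"
    and pos: "\<exists>B \<in> sets \<mu> \<inter> \<S>. emeasure \<mu> B > 0"
    and lim: "\<And>f. test_fun E \<S> f \<Longrightarrow>
      ((\<lambda>t. g t * (\<integral>\<omega>. indicator (\<Union>\<S>) (T (inverse t) (\<xi> \<omega>)) * f (T (inverse t) (\<xi> \<omega>)) \<partial>P))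
           \<longlongrightarrow> (\<integral>x. indicator (\<Union>\<S>) x * f x \<partial>\<mu>)) at_top"
    by auto
  let ?\<nu> = "distr (restrict_space \<mu> F) (borel_of E') \<psi>"
  have spm: "space \<mu> = topspace E" using sets_eq_imp_space_eq[OF smu] by simp
  have FE: "F \<subseteq> topspace E" using F by (rule closedin_subset)
  have Fm: "F \<in> sets \<mu>" unfolding smu by (rule closedin_imp_borel_of[OF F])
  have opU: "openin E (\<Union>\<S>)" by (rule ideal_cutoffs_openin_Union[OF id cut])
  have US': "\<Union>\<S>' = (\<Union>n. B n)" using cover' by blast
  have opU': "openin E' (\<Union>\<S>')" unfolding US' using cover' by blast
  have mem_iff: "x \<in> \<Union>\<S> \<longleftrightarrow> \<psi> x \<in> \<Union>\<S>'" if "x \<in> F" for x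
    using push[OF that] pull that by blast
  have AEF: "AE x in \<mu>. x \<in> F"
  proof (rule AE_I')
    show "topspace E - F \<in> null_sets \<mu>"
      using RV_tail_measure_outside_closed[OF RV F _ cut cover] TF xi sets.compl_sets[OF Fm] spm
      by (auto intro!: null_setsI)
  qed (auto simp: spm)
  have \<psi>_meas': "\<psi> \<in> restrict_space (borel_of E) F \<rightarrow>\<^sub>M borel_of E'"
    by (rule continuous_map_borel_of_restrict[OF \<psi>(1)])
  have rs: "sets (restrict_space \<mu> F) = sets (restrict_space (borel_of E) F)"
    by (simp add: sets_restrict_space smu)
  have \<psi>_meas: "\<psi> \<in> restrict_space \<mu> F \<rightarrow>\<^sub>M borel_of E'"
    using \<psi>_meas' by (simp add: measurable_cong_sets[OF rs refl])
  have spr: "space (restrict_space \<mu> F) = F" using FE by (auto simp: space_restrict_space spm)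
  have pre: "{x \<in> F. \<psi> x \<in> C} \<in> sets \<mu>" if "C \<in> sets (borel_of E')" for C
  proof -
    have "\<psi> -` C \<inter> space (restrict_space \<mu> F) \<in> sets (restrict_space \<mu> F)"
      by (rule measurable_sets[OF \<psi>_meas that])
    moreover have "\<psi> -` C \<inter> space (restrict_space \<mu> F) = {x \<in> F. \<psi> x \<in> C}" by (auto simp: spr)
    ultimately show ?thesis using Fm by (auto simp: sets_restrict_space)
  qed
  have em: "emeasure ?\<nu> C = emeasure \<mu> {x \<in> F. \<psi> x \<in> C}" if "C \<in> sets (borel_of E')" for C
  proof -
    have "emeasure ?\<nu> C = emeasure (restrict_space \<mu> F) {x \<in> F. \<psi> x \<in> C}"
      using that by (subst emeasure_distr[OF \<psi>_meas]) (auto simp: spr vimage_def Int_def conj_commute)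
    also have "\<dots> = emeasure \<mu> {x \<in> F. \<psi> x \<in> C}"
      using Fm by (intro emeasure_restrict_space) auto
    finally show ?thesis .
  qed
  have re': "random_element P E' (\<lambda>\<omega>. \<psi> (\<xi> \<omega>))"
    unfolding random_element_def
  proof
    show "prob_space P" using re by (simp add: random_element_def)
    have "\<xi> \<in> P \<rightarrow>\<^sub>M restrict_space (borel_of E) F"
      using re xi by (intro measurable_restrict_space2) (auto simp: random_element_def)
    from measurable_compose[OF this \<psi>_meas']
    show "(\<lambda>\<omega>. \<psi> (\<xi> \<omega>)) \<in> P \<rightarrow>\<^sub>M borel_of E'" .
  qed
  have fin': "emeasure ?\<nu> C < \<infinity>" if "C \<in> sets ?\<nu> \<inter> \<S>'" for C
    using that em[of C] fin[OF pre pull, of C] by auto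
  have out': "emeasure ?\<nu> C = 0" if "C \<in> sets ?\<nu>" "C \<inter> \<Union>\<S>' = {}" for C
  proof -
    have "{x \<in> F. \<psi> x \<in> C} \<inter> \<Union>\<S> = {}" using that mem_iff by blast
    with that show ?thesis using em[of C] out[OF pre, of C] by auto
  qed
  have pos': "\<exists>C \<in> sets ?\<nu> \<inter> \<S>'. emeasure ?\<nu> C > 0"
  proof (rule ccontr)
    \<comment> \<open>Otherwise all preimages of the B n are null, and so is the part of the union of the ideal
      in F, which carries all the mass.\<close>
    assume "\<not> (\<exists>C \<in> sets ?\<nu> \<inter> \<S>'. emeasure ?\<nu> C > 0)"
    then have z: "emeasure ?\<nu> (B n) = 0" for n
      using cover'(2)[of n] openin_imp_borel_of[OF cover'(1)[of n]] by (auto simp: not_gr_zero)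
    have "{x \<in> F. \<psi> x \<in> B n} \<in> null_sets \<mu>" for n
      using z[of n] em[OF openin_imp_borel_of[OF cover'(1)[of n]]] pre[OF openin_imp_borel_of[OF cover'(1)[of n]]]
      by (auto intro!: null_setsI)
    then have "(\<Union>n. {x \<in> F. \<psi> x \<in> B n}) \<in> null_sets \<mu>" by (intro null_sets_UN) auto
    moreover have "(\<Union>n. {x \<in> F. \<psi> x \<in> B n}) = F \<inter> \<Union>\<S>" using mem_iff[unfolded US'] by blast
    ultimately have "AE x in \<mu>. x \<notin> F \<inter> \<Union>\<S>" using AE_not_in[of "F \<inter> \<Union>\<S>" \<mu>] by simp
    with AEF have ae: "AE x in \<mu>. x \<notin> \<Union>\<S>" by eventually_elim auto
    obtain C where C: "C \<in> sets \<mu>" "C \<in> \<S>" "emeasure \<mu> C > 0" using pos by blast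
    have "AE x in \<mu>. x \<notin> C" using ae C(2) by (auto elim!: eventually_mono)
    then have "emeasure \<mu> C = 0" using AE_iff_null_sets[OF C(1)] by auto
    with C(3) show False by simp
  qed
  have lim': "\<forall>f. test_fun E' \<S>' f \<longrightarrow> ((\<lambda>t. g t * (\<integral>\<omega>. indicator (\<Union>\<S>') (T' (inverse t) (\<psi> (\<xi> \<omega>))) * f (T' (inverse t) (\<psi> (\<xi> \<omega>))) \<partial>P))
           \<longlongrightarrow> (\<integral>x. indicator (\<Union>\<S>') x * f x \<partial>?\<nu>)) at_top"
  proof (intro allI impI)
    fix f assume f: "test_fun E' \<S>' f"
    let ?Z = "E' closure_of {x \<in> \<Union>\<S>'. f x \<noteq> 0}"
    from f have f_cont: "continuous_map (subtopology E' (\<Union>\<S>')) euclideanreal f"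
      and f_bdd: "bounded (f ` \<Union>\<S>')" and Z: "?Z \<in> \<S>'" by (auto simp: test_fun_def)
    obtain b where b: "\<And>x. x \<in> \<Union>\<S>' \<Longrightarrow> \<bar>f x\<bar> \<le> b" using f_bdd unfolding bounded_iff by auto
    define b' where "b' = max b 0"
    from cut pull[OF Z] obtain c where c: "continuous_map E euclideanreal c" "\<And>x. 0 \<le> c x" "\<And>x. c x \<le> 1"
      "\<And>x. x \<in> {x \<in> F. \<psi> x \<in> ?Z} \<Longrightarrow> c x = 1" "E closure_of {x \<in> topspace E. c x \<noteq> 0} \<in> \<S>"
      by (rule ideal_cutoffsE) blast
    let ?EU = "subtopology E (\<Union>\<S>)"
    have "normal_space ?EU"
      using met by (intro metrizable_imp_normal_space metrizable_space_subtopology)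
    moreover have "closedin ?EU (F \<inter> \<Union>\<S>)"
      using F by (auto simp: closedin_subtopology)
    moreover have "continuous_map (subtopology ?EU (F \<inter> \<Union>\<S>)) euclideanreal (f \<circ> \<psi>)"
    proof (rule continuous_map_compose[OF _ f_cont])
      have "subtopology ?EU (F \<inter> \<Union>\<S>) = subtopology (subtopology E F) (F \<inter> \<Union>\<S>)"
        by (simp add: subtopology_subtopology Int_commute Int_left_commute)
      then show "continuous_map (subtopology ?EU (F \<inter> \<Union>\<S>)) (subtopology E' (\<Union>\<S>')) \<psi>"
        using \<psi>(1) mem_iff by (auto simp: continuous_map_in_subtopology intro: continuous_map_from_subtopology)
    qed
    moreover have "(f \<circ> \<psi>) ` (F \<inter> \<Union>\<S>) \<subseteq> {-b'..b'}"
      using b mem_iff by (fastforce simp: b'_def abs_le_iff)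
    moreover have "- b' \<le> b'" by (simp add: b'_def)
    ultimately obtain h where h: "continuous_map ?EU euclideanreal h"
      "\<And>x. x \<in> F \<inter> \<Union>\<S> \<Longrightarrow> h x = (f \<circ> \<psi>) x" "h ` topspace ?EU \<subseteq> {-b'..b'}"
      by (rule Tietze_extension_closed_real_interval[of ?EU "F \<inter> \<Union>\<S>" "f \<circ> \<psi>" "-b'" b']) blast
    have UE: "\<Union>\<S> \<subseteq> topspace E" by (rule openin_subset[OF opU])
    have h_bdd: "\<bar>h x\<bar> \<le> b'" if "x \<in> \<Union>\<S>" for x
    proof -
      have "x \<in> topspace ?EU" using that UE by auto
      then have "h x \<in> {-b'..b'}" using h(3) by blast
      then show ?thesis by (simp add: abs_le_iff)
    qed
    let ?f = "\<lambda>x. c x * h x"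
    have tf: "test_fun E \<S> ?f"
      by (rule cutoff_times_test_fun[OF id c(1,2,3,5) h(1) h_bdd])
    \<comment> \<open>On F the new test function agrees with the pullback: where the pullback is nonzero the
      cutoff is 1.\<close>
    have eq: "indicator (\<Union>\<S>) x * ?f x = indicator (\<Union>\<S>') (\<psi> x) * f (\<psi> x)" if x: "x \<in> F" for x
    proof (cases "x \<in> \<Union>\<S>")
      case True
      then have y: "\<psi> x \<in> \<Union>\<S>'" using mem_iff[OF x] by simp
      have "?f x = f (\<psi> x)"
      proof (cases "f (\<psi> x) = 0")
        case False
        have "{x \<in> \<Union>\<S>'. f x \<noteq> 0} \<subseteq> topspace E'" using openin_subset[OF opU'] by blast
        then have "\<psi> x \<in> ?Z" using closure_of_subset[of "{x \<in> \<Union>\<S>'. f x \<noteq> 0}" E'] y False by blast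
        then have "c x = 1" using c(4)[of x] x by blast
        then show ?thesis using h(2)[of x] x True by simp
      qed (use h(2)[of x] x True in simp)
      then show ?thesis using True y by simp
    next
      case False
      then show ?thesis using mem_iff[OF x] by (simp add: indicator_def)
    qed
    have fm: "(\<lambda>x. indicator (\<Union>\<S>') x * f x) \<in> borel_measurable (borel_of E')"
      by (rule borel_measurable_indicator_times[OF opU' f_cont])
    have "(\<integral>x. indicator (\<Union>\<S>') x * f x \<partial>?\<nu>) = (\<integral>x. indicator (\<Union>\<S>') (\<psi> x) * f (\<psi> x) \<partial>restrict_space \<mu> F)"
      by (rule integral_distr[OF \<psi>_meas fm])
    also have "\<dots> = (\<integral>x. indicator (\<Union>\<S>) x * ?f x \<partial>restrict_space \<mu> F)"
      by (rule Bochner_Integration.integral_cong[OF refl]) (simp add: spr eq)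
    also have "\<dots> = (\<integral>x. indicator F x *\<^sub>R (indicator (\<Union>\<S>) x * ?f x) \<partial>\<mu>)"
      using Fm by (subst integral_restrict_space) (auto simp: set_lebesgue_integral_def)
    also have "\<dots> = (\<integral>x. indicator (\<Union>\<S>) x * ?f x \<partial>\<mu>)"
    proof (rule integral_cong_AE)
      show m: "(\<lambda>x. indicator (\<Union>\<S>) x * ?f x) \<in> borel_measurable \<mu>"
        unfolding measurable_cong_sets[OF smu refl]
        by (intro borel_measurable_indicator_times opU continuous_map_from_subtopology
            continuous_map_real_mult c(1) h(1))
      then show "(\<lambda>x. indicator F x *\<^sub>R (indicator (\<Union>\<S>) x * ?f x)) \<in> borel_measurable \<mu>"
        using Fm by measurable
      show "AE x in \<mu>. indicator F x *\<^sub>R (indicator (\<Union>\<S>) x * ?f x) = indicator (\<Union>\<S>) x * ?f x"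
        using AEF by eventually_elim simp
    qed
    finally have I: "(\<integral>x. indicator (\<Union>\<S>') x * f x \<partial>?\<nu>) = (\<integral>x. indicator (\<Union>\<S>) x * ?f x \<partial>\<mu>)" .
    have "\<forall>\<^sub>F t in at_top.
        g t * (\<integral>\<omega>. indicator (\<Union>\<S>) (T (inverse t) (\<xi> \<omega>)) * ?f (T (inverse t) (\<xi> \<omega>)) \<partial>P) =
        g t * (\<integral>\<omega>. indicator (\<Union>\<S>') (T' (inverse t) (\<psi> (\<xi> \<omega>))) * f (T' (inverse t) (\<psi> (\<xi> \<omega>))) \<partial>P)"
      using eventually_gt_at_top[of 0]
    proof eventually_elim
      case (elim t)
      have "indicator (\<Union>\<S>) (T (inverse t) (\<xi> \<omega>)) * ?f (T (inverse t) (\<xi> \<omega>)) =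
          indicator (\<Union>\<S>') (T' (inverse t) (\<psi> (\<xi> \<omega>))) * f (T' (inverse t) (\<psi> (\<xi> \<omega>)))"
        if "\<omega> \<in> space P" for \<omega>
        using eq[OF TF[OF _ xi[OF that], of "inverse t"]] \<psi>(2)[OF _ xi[OF that], of "inverse t"] elim
        by simp
      then show ?case by (intro arg_cong[where f="(*) (g t)"] Bochner_Integration.integral_cong refl)
    qed
    from Lim_transform_eventually[OF lim[OF tf] this]
    show "((\<lambda>t. g t * (\<integral>\<omega>. indicator (\<Union>\<S>') (T' (inverse t) (\<psi> (\<xi> \<omega>))) * f (T' (inverse t) (\<psi> (\<xi> \<omega>))) \<partial>P))
        \<longlongrightarrow> (\<integral>x. indicator (\<Union>\<S>') x * f x \<partial>?\<nu>)) at_top" unfolding I .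
  qed
  show ?thesis
    unfolding RV_def
    by (intro conjI lim' pos' E' re' gg sets_distr ballI impI; (erule fin' | rule out'; assumption))
qed

section \<open>The hyperspace of compact sets\<close>

lemma hausdorff_dist_commute: "hausdorff_dist K L = hausdorff_dist L K"
  by (simp add: hausdorff_dist_def dist_commute max.commute)

lemma hausdorff_dist_lessD:
  assumes "hausdorff_dist K L < e" "x \<in> K"
  shows "\<exists>y\<in>L. ennreal (dist x y) < e"
proof -
  have "(INF y\<in>L. ennreal (dist x y)) \<le> hausdorff_dist K L"
    unfolding hausdorff_dist_def using assms(2) by (auto intro: SUP_upper max.coboundedI1)
  then have "(INF y\<in>L. ennreal (dist x y)) < e"
    using assms(1) by (rule le_less_trans)
  then show ?thesis by (simp add: INF_less_iff)
qed

lemma hausdorff_dist_leI: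
  assumes "\<And>x. x \<in> K \<Longrightarrow> \<exists>y\<in>L. ennreal (dist x y) \<le> e"
    and "\<And>y. y \<in> L \<Longrightarrow> \<exists>x\<in>K. ennreal (dist x y) \<le> e"
  shows "hausdorff_dist K L \<le> e"
proof -
  have "(SUP x\<in>K. INF y\<in>L. ennreal (dist x y)) \<le> e"
    using assms(1) by (intro SUP_least) (meson INF_lower2)
  moreover have "(SUP y\<in>L. INF x\<in>K. ennreal (dist x y)) \<le> e"
    using assms(2) by (intro SUP_least) (meson INF_lower2)
  ultimately show ?thesis by (simp add: hausdorff_dist_def)
qed

text \<open>
  Nearest points need not exist in arbitrary sets, so points at distance below \<open>a\<close>
  and \<open>b\<close> are used, where \<open>a\<close> and \<open>b\<close> are slightly larger
  than the two Hausdorff distances.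
\<close>

lemma hausdorff_dist_triangle:
  "hausdorff_dist K M \<le> hausdorff_dist K L + hausdorff_dist L M"
proof (rule ennreal_le_epsilon)
  fix e :: real
  assume fin: "hausdorff_dist K L + hausdorff_dist L M < top" and e: "0 < e"
  define a where "a = hausdorff_dist K L + ennreal (e/2)"
  define b where "b = hausdorff_dist L M + ennreal (e/2)"
  have a: "hausdorff_dist K L < a" and b: "hausdorff_dist L M < b"
    using fin e by (auto simp: a_def b_def ennreal_add_eq_top less_top intro!: ennreal_lessI
        simp: ennreal_less_zero_iff)
  have "hausdorff_dist K M \<le> a + b"
  proof (rule hausdorff_dist_leI)
    fix x assume "x \<in> K"
    then obtain y where y: "y \<in> L" "ennreal (dist x y) < a" using hausdorff_dist_lessD[OF a] by blast
    then obtain z where z: "z \<in> M" "ennreal (dist y z) < b" using hausdorff_dist_lessD[OF b] by blast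
    have "ennreal (dist x z) \<le> ennreal (dist x y) + ennreal (dist y z)"
      by (simp add: dist_triangle ennreal_leI flip: ennreal_plus)
    also have "\<dots> \<le> a + b" using y z by (intro add_mono) auto
    finally show "\<exists>z\<in>M. ennreal (dist x z) \<le> a + b" using z by blast
  next
    fix z assume "z \<in> M"
    then obtain y where y: "y \<in> L" "ennreal (dist z y) < b"
      using hausdorff_dist_lessD[of M L b z] b hausdorff_dist_commute[of L M] by auto
    then obtain x where x: "x \<in> K" "ennreal (dist y x) < a"
      using hausdorff_dist_lessD[of L K a y] a hausdorff_dist_commute[of L K] by auto
    have "ennreal (dist x z) \<le> ennreal (dist y x) + ennreal (dist z y)"
      by (metis dist_commute dist_triangle ennreal_leI ennreal_plus zero_le_dist)
    also have "\<dots> \<le> a + b" using x y by (intro add_mono) auto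
    finally show "\<exists>x\<in>K. ennreal (dist x z) \<le> a + b" using x by blast
  qed
  also have "a + b = hausdorff_dist K L + hausdorff_dist L M + ennreal e"
  proof -
    have "ennreal e = ennreal (e/2) + ennreal (e/2)" using e by (simp flip: ennreal_plus)
    then show ?thesis by (simp add: a_def b_def algebra_simps)
  qed
  finally show "hausdorff_dist K M \<le> hausdorff_dist K L + hausdorff_dist L M + ennreal e" .
qed

text \<open>
  Truncation at 1 turns the extended distance, which is infinite between the empty set and every
  nonempty set, into a genuine metric with the same small balls.
\<close>

definition bounded_hausdorff_dist :: "'a::euclidean_space set \<Rightarrow> 'a set \<Rightarrow> real" where
  "bounded_hausdorff_dist K L = enn2real (min 1 (hausdorff_dist K L))"

lemma ennreal_bounded_hausdorff_dist:
  "ennreal (bounded_hausdorff_dist K L) = min 1 (hausdorff_dist K L)"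
proof -
  have "min 1 (hausdorff_dist K L) < top" by (simp add: min_less_iff_disj)
  then show ?thesis by (simp add: bounded_hausdorff_dist_def)
qed

lemma hausdorff_dist_refl: "hausdorff_dist K K = 0"
  using hausdorff_dist_leI[of K K 0] by fastforce

lemma hausdorff_dist_eq_0D:
  assumes "closed L" "hausdorff_dist K L = 0"
  shows "K \<subseteq> L"
proof
  fix x assume "x \<in> K"
  have "\<exists>y\<in>L. dist y x < e" if "e > 0" for e :: real
    using hausdorff_dist_lessD[of K L "ennreal e" x] assms \<open>x \<in> K\<close> that
    by (auto simp: ennreal_less_iff dist_commute)
  then have "x \<in> closure L" by (simp add: closure_approachable)
  with assms show "x \<in> L" by simp
qed

lemma Metric_space_bounded_hausdorff_dist:
  "Metric_space {K::'a::euclidean_space set. compact K} bounded_hausdorff_dist"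
proof
  fix K L M :: "'a set"
  show "0 \<le> bounded_hausdorff_dist K L" by (simp add: bounded_hausdorff_dist_def)
  show "bounded_hausdorff_dist K L = bounded_hausdorff_dist L K"
    by (simp add: bounded_hausdorff_dist_def hausdorff_dist_commute)
  show "bounded_hausdorff_dist K L = 0 \<longleftrightarrow> K = L"
    if "K \<in> {K. compact K}" "L \<in> {K. compact K}"
  proof
    assume "bounded_hausdorff_dist K L = 0"
    then have "hausdorff_dist K L = 0"
      using ennreal_bounded_hausdorff_dist[of K L] by (auto simp: min_def split: if_splits)
    then show "K = L" using that hausdorff_dist_eq_0D[of L K] hausdorff_dist_eq_0D[of K L]
      by (auto simp: hausdorff_dist_commute compact_imp_closed)
  qed (simp add: bounded_hausdorff_dist_def hausdorff_dist_refl)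
  have "ennreal (bounded_hausdorff_dist K M)
      \<le> ennreal (bounded_hausdorff_dist K L + bounded_hausdorff_dist L M)"
  proof -
    have "min 1 x \<le> min 1 y + min 1 z" if "x \<le> y + z" for x y z :: ennreal
    proof (cases "y \<le> 1 \<and> z \<le> 1")
      case True
      then show ?thesis using that by (simp add: min.coboundedI2)
    next
      case False
      then have "1 \<le> min 1 y + min 1 z"
        by (metis add_increasing add_increasing2 min.cobounded1 min_absorb1 nle_le zero_le)
      then show ?thesis by (simp add: min.coboundedI1)
    qed
    from this[OF hausdorff_dist_triangle[of K M L]]
    have "ennreal (bounded_hausdorff_dist K M)
        \<le> ennreal (bounded_hausdorff_dist K L) + ennreal (bounded_hausdorff_dist L M)"
      by (simp add: ennreal_bounded_hausdorff_dist)
    also have "\<dots> = ennreal (bounded_hausdorff_dist K L + bounded_hausdorff_dist L M)"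
      by (rule ennreal_plus[symmetric]) (simp_all add: bounded_hausdorff_dist_def)
    finally show ?thesis .
  qed
  then show "bounded_hausdorff_dist K M \<le> bounded_hausdorff_dist K L + bounded_hausdorff_dist L M"
    by (subst (asm) ennreal_le_iff) (auto simp: bounded_hausdorff_dist_def)
qed

lemma bounded_hausdorff_dist_less_iff:
  assumes "0 < r" "r \<le> 1"
  shows "bounded_hausdorff_dist K L < r \<longleftrightarrow> hausdorff_dist K L < ennreal r"
proof -
  have "bounded_hausdorff_dist K L < r \<longleftrightarrow> ennreal (bounded_hausdorff_dist K L) < ennreal r"
    using assms by (simp add: ennreal_less_iff bounded_hausdorff_dist_def)
  also have "\<dots> \<longleftrightarrow> hausdorff_dist K L < ennreal r"
    using assms by (auto simp: ennreal_bounded_hausdorff_dist min_less_iff_disj not_less)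
  finally show ?thesis .
qed

text \<open>
  The balls of the extended distance with arbitrary centres and radii are open for the truncated
  metric by the triangle inequality; conversely, every ball of radius at most 1 of the truncated
  metric is one of them.
\<close>

lemma
  fixes U :: "'a::euclidean_space set set"
  shows openin_Kd_top_iff: "openin Kd_top U \<longleftrightarrow> U \<subseteq> {K. compact K} \<and>
     (\<forall>K\<in>U. \<exists>r>0. \<forall>L. compact L \<and> hausdorff_dist K L < ennreal r \<longrightarrow> L \<in> U)" (is ?A)
  and Kd_top_eq_mtopology:
  "(Kd_top :: 'a set topology) =
     Metric_space.mtopology {K. compact K} bounded_hausdorff_dist" (is ?B)
proof -
  interpret H: Metric_space "{K::'a set. compact K}" bounded_hausdorff_dist
    by (rule Metric_space_bounded_hausdorff_dist)
  let ?S = "{{L. compact L \<and> hausdorff_dist K L < e} | K e. compact (K::'a set) \<and> e > 0}"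
  have open_iff: "openin H.mtopology U \<longleftrightarrow> U \<subseteq> {K. compact K} \<and>
     (\<forall>K\<in>U. \<exists>r>0. \<forall>L. compact L \<and> hausdorff_dist K L < ennreal r \<longrightarrow> L \<in> U)" for U
  proof -
    have "(\<exists>r>0. H.mball K r \<subseteq> U) \<longleftrightarrow>
        (\<exists>r>0. \<forall>L. compact L \<and> hausdorff_dist K L < ennreal r \<longrightarrow> L \<in> U)" if "compact K" for K
    proof -
      have ball: "H.mball K r = {L. compact L \<and> hausdorff_dist K L < ennreal r}" if "0 < r" "r \<le> 1" for r
        using bounded_hausdorff_dist_less_iff[OF that, of K] \<open>compact K\<close>
        by (auto simp: H.mball_def)
      show ?thesis
      proof
        assume "\<exists>r>0. H.mball K r \<subseteq> U"
        then obtain r where r: "r > 0" "H.mball K r \<subseteq> U" by blast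
        have "H.mball K (min r 1) \<subseteq> U"
          using H.mball_subset_concentric[of "min r 1" r K] r(2) by auto
        then show "\<exists>r>0. \<forall>L. compact L \<and> hausdorff_dist K L < ennreal r \<longrightarrow> L \<in> U"
          using ball[of "min r 1"] r(1) by (intro exI[of _ "min r 1"]) auto
      next
        assume "\<exists>r>0. \<forall>L. compact L \<and> hausdorff_dist K L < ennreal r \<longrightarrow> L \<in> U"
        then obtain r where r: "r > 0" "\<And>L. compact L \<Longrightarrow> hausdorff_dist K L < ennreal r \<Longrightarrow> L \<in> U"
          by blast
        have "L \<in> U" if "L \<in> H.mball K (min r 1)" for L
        proof -
          have "compact L" and L: "hausdorff_dist K L < ennreal (min r 1)"
            using that ball[of "min r 1"] r(1) by auto
          have "ennreal (min r 1) \<le> ennreal r" by (rule ennreal_leI) simp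
          with L have "hausdorff_dist K L < ennreal r" by (rule less_le_trans)
          then show ?thesis using r(2) \<open>compact L\<close> by blast
        qed
        then show "\<exists>r>0. H.mball K r \<subseteq> U" using r(1) by (intro exI[of _ "min r 1"]) auto
      qed
    qed
    then show ?thesis unfolding H.openin_mtopology subset_iff mem_Collect_eq Ball_def by (intro conj_cong all_cong) simp_all
  qed
  have basis_open: "openin H.mtopology V" if "V \<in> ?S" for V
  proof -
    from that obtain K e where V: "V = {L. compact L \<and> hausdorff_dist K L < e}" by blast
    show ?thesis unfolding open_iff
    proof safe
      fix L assume "L \<in> V"
      then have L: "compact L" "hausdorff_dist K L < e" by (auto simp: V)
      then obtain q where q: "hausdorff_dist K L < q" "q < e" using dense by blast
      obtain r where r: "r > 0" "hausdorff_dist K L + ennreal r \<le> q"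
      proof -
        have qt: "q < top" using q(2) by (auto intro: less_le_trans)
        obtain h where h: "h \<ge> 0" "hausdorff_dist K L = ennreal h" 
          using q(1) qt by (metis less_top ennreal_cases order_less_trans)
        obtain q' where q': "q' \<ge> 0" "q = ennreal q'" using qt by (metis less_top ennreal_cases)
        have "h < q'" using q h q' by (simp add: ennreal_less_iff)
        with h q' show thesis by (intro that[of "q' - h"]) (simp_all flip: ennreal_plus)
      qed
      show "\<exists>r>0. \<forall>M. compact M \<and> hausdorff_dist L M < ennreal r \<longrightarrow> M \<in> V"
      proof (intro exI conjI allI impI, rule r(1))
        fix M assume M: "compact M \<and> hausdorff_dist L M < ennreal r"
        have "hausdorff_dist K M \<le> hausdorff_dist K L + hausdorff_dist L M"
          by (rule hausdorff_dist_triangle)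
        also have "\<dots> \<le> hausdorff_dist K L + ennreal r" using M by (intro add_mono) auto
        also have "\<dots> < e" using r q by (blast intro: le_less_trans)
        finally show "M \<in> V" using M by (simp add: V)
      qed
    qed (auto simp: V)
  qed
  have top: "\<Union> ?S = {K. compact K}"
  proof -
    have "K \<in> \<Union> ?S" if "compact K" for K
      using that by (intro UnionI[of "{L. compact L \<and> hausdorff_dist K L < 1}"])
        (auto simp: hausdorff_dist_refl intro!: exI[of _ K] exI[of _ "1::ennreal"])
    then show ?thesis by blast
  qed
  have le: "openin H.mtopology U" if "openin Kd_top U" for U
  proof -
    have "continuous_map H.mtopology Kd_top (\<lambda>K. K)"
      unfolding Kd_top_def
    proof (rule continuous_on_generated_topo)
      fix V assume V: "V \<in> ?S"
      then have "(\<lambda>K. K) -` V \<inter> topspace H.mtopology = V" using top by auto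
      then show "openin H.mtopology ((\<lambda>K. K) -` V \<inter> topspace H.mtopology)"
        using basis_open[OF V] by simp
    qed (use top in auto)
    from openin_continuous_map_preimage[OF this that]
    have "openin H.mtopology {x \<in> topspace H.mtopology. x \<in> U}" .
    moreover have "U \<subseteq> {K. compact K}"
      using openin_subset[OF that] top by (simp add: Kd_top_def)
    then have "{x \<in> topspace H.mtopology. x \<in> U} = U" by auto
    ultimately show ?thesis by simp
  qed
  have ge: "openin Kd_top U" if "openin H.mtopology U" for U
  proof (subst openin_subopen, intro ballI)
    fix K assume K: "K \<in> U"
    with that obtain r where "compact K" and r: "r > 0"
      "\<forall>L. compact L \<and> hausdorff_dist K L < ennreal r \<longrightarrow> L \<in> U"
      unfolding open_iff by blast
    let ?V = "{L. compact L \<and> hausdorff_dist K L < ennreal r}"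
    have "openin Kd_top ?V" unfolding Kd_top_def
      using \<open>compact K\<close> r(1)
      by (intro topology_generated_by_Basis) (auto intro!: exI[of _ K] exI[of _ "ennreal r"])
    moreover have "K \<in> ?V" using \<open>compact K\<close> r(1) by (simp add: hausdorff_dist_refl)
    ultimately show "\<exists>T. openin Kd_top T \<and> K \<in> T \<and> T \<subseteq> U" using r(2) by blast
  qed
  show ?B using le ge by (auto simp: topology_eq)
  then show ?A using open_iff by simp
qed

lemma topspace_Kd_top: "topspace Kd_top = {K. compact K}"
  by (simp add: Kd_top_eq_mtopology Metric_space.topspace_mtopology Metric_space_bounded_hausdorff_dist)

lemma metrizable_space_Kd_top: "metrizable_space Kd_top"
  unfolding Kd_top_eq_mtopology
  by (rule Metric_space.metrizable_space_mtopology[OF Metric_space_bounded_hausdorff_dist])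

lemma openin_Kd_top_hit:
  assumes "open G"
  shows "openin Kd_top {K. compact K \<and> K \<inter> G \<noteq> {}}"
  unfolding openin_Kd_top_iff
proof (intro conjI ballI)
  fix K assume "K \<in> {K. compact K \<and> K \<inter> G \<noteq> {}}"
  then obtain x where x: "x \<in> K" "x \<in> G" by blast
  then obtain r where r: "r > 0" "ball x r \<subseteq> G" using assms open_contains_ball by blast
  show "\<exists>r>0. \<forall>L. compact L \<and> hausdorff_dist K L < ennreal r \<longrightarrow> L \<in> {K. compact K \<and> K \<inter> G \<noteq> {}}"
    using r x hausdorff_dist_lessD[of K _ "ennreal r" x]
    by (intro exI[of _ r]) (force simp: ennreal_less_iff subset_iff)
qed auto

text \<open>
  A compact set disjoint from a closed set has positive distance from it.
\<close>

lemma openin_Kd_top_miss: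
  assumes "closed C"
  shows "openin Kd_top {K. compact K \<and> K \<inter> C = {}}"
  unfolding openin_Kd_top_iff
proof (intro conjI ballI)
  fix K assume "K \<in> {K. compact K \<and> K \<inter> C = {}}"
  then obtain r where r: "r > 0" "\<And>x y. x \<in> K \<Longrightarrow> y \<in> C \<Longrightarrow> r \<le> dist x y"
    using separate_compact_closed[of K C] assms by auto
  have "L \<inter> C = {}" if KL: "hausdorff_dist K L < ennreal r" for L
  proof (rule ccontr)
    assume "L \<inter> C \<noteq> {}"
    then obtain y where "y \<in> L" "y \<in> C" by blast
    then obtain x where "x \<in> K" "dist y x < r"
      using hausdorff_dist_lessD[of L K "ennreal r" y] KL r(1)
      by (auto simp: hausdorff_dist_commute[of K L] ennreal_less_iff)
    then show False using r(2)[of x y] \<open>y \<in> C\<close> by (simp add: dist_commute)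
  qed
  then show "\<exists>r>0. \<forall>L. compact L \<and> hausdorff_dist K L < ennreal r \<longrightarrow> L \<in> {K. compact K \<and> K \<inter> C = {}}"
    using r(1) by auto
qed auto

text \<open>
  The hit and miss sets generate the Hausdorff topology on compact sets: if \<open>L\<close>
  misses the complement of the \<open>r/2\<close>-neighbourhood of \<open>K\<close> and hits each
  of finitely many balls of radius \<open>r/3\<close> covering \<open>K\<close>, then the distance
  of \<open>K\<close> and \<open>L\<close> is at most \<open>2r/3\<close>. This also covers the
  empty set, whose neighbourhood is empty.
\<close>

lemma continuous_map_Kd_top_hit_miss:
  fixes \<phi> :: "'b \<Rightarrow> 'a::euclidean_space set"
  assumes cpt: "\<And>x. x \<in> topspace X \<Longrightarrow> compact (\<phi> x)"
    and hit: "\<And>G. open G \<Longrightarrow> openin X {x \<in> topspace X. \<phi> x \<inter> G \<noteq> {}}"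
    and miss: "\<And>C. closed C \<Longrightarrow> openin X {x \<in> topspace X. \<phi> x \<inter> C = {}}"
  shows "continuous_map X Kd_top \<phi>"
  unfolding continuous_map
proof (intro conjI allI impI)
  show "\<phi> ` topspace X \<subseteq> topspace Kd_top" using cpt by (auto simp: topspace_Kd_top)
  fix U :: "'a set set" assume U: "openin Kd_top U"
  show "openin X {x \<in> topspace X. \<phi> x \<in> U}"
  proof (subst openin_subopen, intro ballI)
    fix x assume x: "x \<in> {x \<in> topspace X. \<phi> x \<in> U}"
    then have comp: "compact (\<phi> x)" using cpt by auto
    obtain r where r: "r > 0" "\<And>L. compact L \<Longrightarrow> hausdorff_dist (\<phi> x) L < ennreal r \<Longrightarrow> L \<in> U"
      using U x unfolding openin_Kd_top_iff by blast
    obtain N where N: "N \<subseteq> \<phi> x" "finite N" "\<phi> x \<subseteq> (\<Union>y\<in>N. ball y (r/3))"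
      by (rule compactE_image[OF comp, of "\<phi> x" "\<lambda>y. ball y (r/3)"])
        (use r(1) in \<open>auto intro: exI[of _ "r/3"]\<close>)
    define C where "C = - (\<Union>y\<in>\<phi> x. ball y (r/2))"
    define V where "V = {z \<in> topspace X. \<phi> z \<inter> C = {}} \<inter> (\<Inter>y\<in>N. {z \<in> topspace X. \<phi> z \<inter> ball y (r/3) \<noteq> {}})"
    have "closed C" by (auto simp: C_def)
    then have "openin X V"
      unfolding V_def by (cases "N = {}") (auto intro!: openin_Int openin_INT miss hit N(2))
    moreover have "x \<in> V"
      using x N(1) r(1) by (force simp: V_def C_def)
    moreover have "V \<subseteq> {x \<in> topspace X. \<phi> x \<in> U}"
    proof safe
      fix z assume z: "z \<in> V"
      then show zX: "z \<in> topspace X" by (simp add: V_def)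
      have "hausdorff_dist (\<phi> x) (\<phi> z) \<le> ennreal (2*r/3)"
      proof (rule hausdorff_dist_leI)
        fix y assume "y \<in> \<phi> x"
        then obtain n where n: "n \<in> N" "dist n y < r/3" using N by auto
        then have "\<phi> z \<inter> ball n (r/3) \<noteq> {}" using z by (auto simp: V_def)
        then obtain w where w: "w \<in> \<phi> z" "dist n w < r/3" by auto
        have "dist y w \<le> 2*r/3" using dist_triangle[of y w n] n w by (simp add: dist_commute)
        then show "\<exists>w\<in>\<phi> z. ennreal (dist y w) \<le> ennreal (2*r/3)"
          using w(1) by (intro bexI[of _ w] ennreal_leI)
      next
        fix w assume "w \<in> \<phi> z"
        then have "w \<notin> C" using z by (auto simp: V_def)
        then obtain y where "y \<in> \<phi> x" "dist y w < r/2" by (auto simp: C_def)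
        then show "\<exists>y\<in>\<phi> x. ennreal (dist y w) \<le> ennreal (2*r/3)"
          using r(1) by (intro bexI[of _ y]) (auto intro: ennreal_leI)
      qed
      also have "\<dots> < ennreal r" using r(1) by (simp add: ennreal_less_iff)
      finally show "\<phi> z \<in> U" using r(2) cpt zX by blast
    qed
    ultimately show "\<exists>T. openin X T \<and> x \<in> T \<and> T \<subseteq> {x \<in> topspace X. \<phi> x \<in> U}" by blast
  qed
qed

text \<open>
  Hits are preserved under small changes because scaling of vectors is continuous; for misses the
  compactness of \<open>K\<close> is needed, through the tube lemma.
\<close>

lemma scaling_on_Kd_top: "scaling_on Kd_top (dilate_set :: real \<Rightarrow> 'a::euclidean_space set \<Rightarrow> 'a set)"
proof -
  let ?X = "prod_topology (top_of_set {0<..}) (Kd_top :: 'a set topology)"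
  have X: "topspace ?X = {0<..} \<times> {K. compact K}" by (simp add: topspace_Kd_top)
  have "continuous_map ?X Kd_top (\<lambda>(t, K). dilate_set t K)"
  proof (rule continuous_map_Kd_top_hit_miss)
    fix p :: "real \<times> 'a set" assume "p \<in> topspace ?X"
    then show "compact (case p of (t, K) \<Rightarrow> dilate_set t K)"
      unfolding X by (auto simp: dilate_set_def compact_scaling)
  next
    fix G :: "'a set" assume G: "open G"
    show "openin ?X {p \<in> topspace ?X. (case p of (t, K) \<Rightarrow> dilate_set t K) \<inter> G \<noteq> {}}"
    proof (subst openin_subopen, intro ballI)
      fix p :: "real \<times> 'a set" assume "p \<in> {p \<in> topspace ?X. (case p of (t, K) \<Rightarrow> dilate_set t K) \<inter> G \<noteq> {}}"
      then obtain t K x where p: "p = (t, K)" "t > 0" "compact K" "x \<in> K" "t *\<^sub>R x \<in> G"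
        unfolding X by (auto simp: dilate_set_def)
      have "open ((\<lambda>(s, y). s *\<^sub>R y) -` G)"
        by (rule open_vimage[OF G]) (auto intro!: continuous_intros simp: case_prod_beta)
      then obtain A B where AB: "open A" "open B" "(t, x) \<in> A \<times> B" "A \<times> B \<subseteq> (\<lambda>(s, y). s *\<^sub>R y) -` G"
        using p(5) by (auto elim!: open_prod_elim)
      show "\<exists>T. openin ?X T \<and> p \<in> T \<and> T \<subseteq> {p \<in> topspace ?X. (case p of (t, K) \<Rightarrow> dilate_set t K) \<inter> G \<noteq> {}}"
      proof (intro exI[of _ "({0<..} \<inter> A) \<times> {K. compact K \<and> K \<inter> B \<noteq> {}}"] conjI)
        show "openin ?X (({0<..} \<inter> A) \<times> {K. compact K \<and> K \<inter> B \<noteq> {}})"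
          using AB by (auto simp: openin_prod_Times_iff openin_open_Int intro!: openin_Kd_top_hit)
        show "p \<in> ({0<..} \<inter> A) \<times> {K. compact K \<and> K \<inter> B \<noteq> {}}" using AB p by auto
        show "({0<..} \<inter> A) \<times> {K. compact K \<and> K \<inter> B \<noteq> {}} \<subseteq>
            {p \<in> topspace ?X. (case p of (t, K) \<Rightarrow> dilate_set t K) \<inter> G \<noteq> {}}"
          using AB(4) unfolding X dilate_set_def by fastforce
      qed
    qed
  next
    fix C :: "'a set" assume C: "closed C"
    show "openin ?X {p \<in> topspace ?X. (case p of (t, K) \<Rightarrow> dilate_set t K) \<inter> C = {}}"
    proof (subst openin_subopen, intro ballI)
      fix p :: "real \<times> 'a set" assume "p \<in> {p \<in> topspace ?X. (case p of (t, K) \<Rightarrow> dilate_set t K) \<inter> C = {}}"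
      then obtain t K where p: "p = (t, K)" "t > 0" "compact K" "\<And>x. x \<in> K \<Longrightarrow> t *\<^sub>R x \<notin> C"
        unfolding X by (auto simp: dilate_set_def)
      have "open ((\<lambda>(s, y). s *\<^sub>R y) -` (- C))"
        using C by (intro open_vimage) (auto intro!: continuous_intros simp: case_prod_beta)
      moreover have "{t} \<times> K \<subseteq> (\<lambda>(s, y). s *\<^sub>R y) -` (- C)" using p by auto
      ultimately obtain A B where AB: "open A" "open B" "t \<in> A" "K \<subseteq> B"
          "A \<times> B \<subseteq> (\<lambda>(s, y). s *\<^sub>R y) -` (- C)"
        using tube_lemma_right[of euclidean euclidean "(\<lambda>(s, y). s *\<^sub>R y) -` (- C)" K t] p(3)
        by (auto simp: euclidean_product_topology)
      show "\<exists>T. openin ?X T \<and> p \<in> T \<and> T \<subseteq> {p \<in> topspace ?X. (case p of (t, K) \<Rightarrow> dilate_set t K) \<inter> C = {}}"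
      proof (intro exI[of _ "({0<..} \<inter> A) \<times> {K. compact K \<and> K \<inter> (- B) = {}}"] conjI)
        show "openin ?X (({0<..} \<inter> A) \<times> {K. compact K \<and> K \<inter> (- B) = {}})"
          using AB by (auto simp: openin_prod_Times_iff openin_open_Int intro!: openin_Kd_top_miss)
        show "p \<in> ({0<..} \<inter> A) \<times> {K. compact K \<and> K \<inter> (- B) = {}}" using AB p by auto
        show "({0<..} \<inter> A) \<times> {K. compact K \<and> K \<inter> (- B) = {}} \<subseteq>
            {p \<in> topspace ?X. (case p of (t, K) \<Rightarrow> dilate_set t K) \<inter> C = {}}"
          using AB(5) unfolding X dilate_set_def by fastforce
      qed
    qed
  qed
  then show ?thesis
    unfolding scaling_on_def by (auto simp: dilate_set_def[abs_def] image_image split_def)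
qed

lemma ideal_on_K0: "ideal_on (topspace Kd_top) K0"
  unfolding ideal_on_def topspace_Kd_top
proof (intro conjI ballI allI impI)
  fix A B :: "'a set set" assume "A \<in> K0"
  show "B \<subseteq> A \<Longrightarrow> B \<in> K0" using \<open>A \<in> K0\<close> by (auto simp: K0_def intro: less_le_trans INF_superset_mono)
  show "B \<in> K0 \<Longrightarrow> A \<union> B \<in> K0" using \<open>A \<in> K0\<close> by (auto simp: K0_def INF_union inf_min)
qed (auto simp: K0_def)

text \<open>
  Together with \<open>K0_cover\<close>, this gives countably many open members of the ideal whose
  union contains all of its members.
\<close>

lemma K0_hit: "{K. compact K \<and> K \<inter> {x. 1 / Suc n < norm x} \<noteq> {}} \<in> K0"
proof -
  have "ennreal (1 / Suc n) \<le> set_norm K" if "x \<in> K" "1 / Suc n < norm x" for K and x :: 'a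
  proof -
    have "ennreal (1 / Suc n) \<le> ennreal (norm x)" using that(2) by (intro ennreal_leI) simp
    also have "\<dots> \<le> set_norm K" unfolding set_norm_def using that(1) by (rule SUP_upper)
    finally show ?thesis .
  qed
  then have "ennreal (1 / Suc n) \<le> (INF K\<in>{K. compact K \<and> K \<inter> {x::'a. 1 / Suc n < norm x} \<noteq> {}}. set_norm K)"
    by (intro INF_greatest) blast
  moreover have "0 < ennreal (1 / Suc n)" by (subst ennreal_less_zero_iff) simp
  ultimately have "0 < (INF K\<in>{K. compact K \<and> K \<inter> {x::'a. 1 / Suc n < norm x} \<noteq> {}}. set_norm K)"
    by (rule less_le_trans[rotated])
  then show ?thesis by (auto simp: K0_def)
qed

lemma K0_imp_points_away_from_0: "\<A> \<in> K0 \<Longrightarrow> \<exists>\<delta>>0. \<forall>K\<in>\<A>. \<exists>x\<in>K. \<delta> < ennreal (norm x)"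
proof -
  assume "\<A> \<in> K0"
  then have "0 < (INF K\<in>\<A>. set_norm K)" by (simp add: K0_def)
  then obtain \<delta> where \<delta>: "0 < \<delta>" "\<delta> < (INF K\<in>\<A>. set_norm K)" using dense by blast
  have "\<exists>x\<in>K. \<delta> < ennreal (norm x)" if "K \<in> \<A>" for K
    using less_le_trans[OF \<delta>(2) INF_lower[OF that]] by (simp add: set_norm_def less_SUP_iff)
  with \<delta>(1) show ?thesis by blast
qed

lemma K0_cover: "\<Union>K0 \<subseteq> (\<Union>n::nat. {K. compact K \<and> K \<inter> {x. 1 / Suc n < norm x} \<noteq> {}})"
proof
  fix K assume "K \<in> \<Union>K0"
  then obtain \<A> where \<A>: "\<A> \<in> K0" "K \<in> \<A>" by blast
  then have K: "compact K" by (auto simp: K0_def)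
  obtain \<delta> x where "0 < \<delta>" "x \<in> K" "\<delta> < ennreal (norm x)" using K0_imp_points_away_from_0[OF \<A>(1)] \<A>(2) by blast
  then have "norm x > 0" by (metis ennreal_0 norm_eq_zero not_less_zero zero_less_norm_iff)
  then obtain n where "inverse (real (Suc n)) < norm x" using reals_Archimedean by blast
  then have "1 / Suc n < norm x" by (simp add: inverse_eq_divide)
  then show "K \<in> (\<Union>n::nat. {K. compact K \<and> K \<inter> {x. 1 / Suc n < norm x} \<noteq> {}})"
    using K \<open>x \<in> K\<close> by blast
qed

section \<open>Atoms of point measures and the vague topology\<close>

lemma R0_iff: "A \<in> R0 \<longleftrightarrow> (\<exists>\<delta>>0. \<forall>x\<in>A. \<delta> \<le> norm x)"
proof
  assume "A \<in> R0"
  then have "0 < (INF x\<in>A. ennreal (norm x))" by (simp add: R0_def)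
  then obtain q where q: "0 < q" "q < (INF x\<in>A. ennreal (norm x))" using dense by blast
  then have "q < top" by (rule_tac less_le_trans) auto
  with q(1) obtain \<delta> where \<delta>: "q = ennreal \<delta>" "\<delta> > 0"
    by (cases q) auto
  have "\<delta> \<le> norm x" if "x \<in> A" for x
  proof -
    have "ennreal \<delta> < ennreal (norm x)"
      using less_le_trans[OF q(2) INF_lower[OF that]] \<delta>(1) by simp
    then show ?thesis using \<delta>(2) by (simp add: ennreal_less_iff)
  qed
  then show "\<exists>\<delta>>0. \<forall>x\<in>A. \<delta> \<le> norm x" using \<delta>(2) by blast
next
  assume "\<exists>\<delta>>0. \<forall>x\<in>A. \<delta> \<le> norm x"
  then obtain \<delta> where \<delta>: "\<delta> > 0" "\<And>x. x \<in> A \<Longrightarrow> \<delta> \<le> norm x" by blast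
  then have le: "ennreal \<delta> \<le> (INF x\<in>A. ennreal (norm x))"
    by (intro INF_greatest ennreal_leI)
  have "0 < ennreal \<delta>" using \<delta>(1) by simp
  then have "0 < (INF x\<in>A. ennreal (norm x))" using le by (rule less_le_trans)
  then show "A \<in> R0" by (simp add: R0_def)
qed

lemma norm_ge_R0: "\<delta> > 0 \<Longrightarrow> {x. \<delta> \<le> norm x} \<in> R0"
  by (auto simp: R0_iff)

lemma R0_0_notin: "A \<in> R0 \<Longrightarrow> 0 \<notin> A"
  by (force simp: R0_iff)

lemma closed_imp_R0: "closed C \<Longrightarrow> 0 \<notin> C \<Longrightarrow> C \<in> R0"
proof -
  assume "closed C" "0 \<notin> C"
  then obtain e where "e > 0" "ball 0 e \<subseteq> - C"
    using open_contains_ball[of "- C"] by (auto simp: closed_def)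
  then show "C \<in> R0" unfolding R0_iff by (intro exI[of _ e]) (force simp: subset_iff)
qed

lemma closed_norm_ge: "closed {x::'a::euclidean_space. \<delta> \<le> ennreal (norm x)}"
  by (intro closed_Collect_le continuous_intros continuous_on_ennreal)

lemma norm_ge_ennreal_R0: "0 < \<delta> \<Longrightarrow> {x. \<delta> \<le> ennreal (norm x)} \<in> R0"
  unfolding R0_def by (auto intro!: less_le_trans[of 0 \<delta>] INF_greatest)

lemma space_punctured_borel: "space punctured_borel = - {0}"
  by (simp add: punctured_borel_def space_restrict_space)

lemma sets_punctured_borel: "A \<in> sets punctured_borel \<longleftrightarrow> A \<in> sets borel \<and> 0 \<notin> A"
proof -
  have "A \<in> sets punctured_borel \<longleftrightarrow> A \<in> (\<inter>) (- {0}) ` sets borel"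
    by (simp add: punctured_borel_def sets_restrict_space)
  also have "\<dots> \<longleftrightarrow> A \<in> sets borel \<and> 0 \<notin> A"
  proof
    assume "A \<in> sets borel \<and> 0 \<notin> A"
    then show "A \<in> (\<inter>) (- {0}) ` sets borel" by (intro image_eqI[of _ _ A]) auto
  next
    assume "A \<in> (\<inter>) (- {0}) ` sets borel"
    then obtain B where "B \<in> sets borel" "A = - {0} \<inter> B" by blast
    then show "A \<in> sets borel \<and> 0 \<notin> A" by auto
  qed
  finally show ?thesis .
qed

lemma Mp_sets: "m \<in> Mp \<Longrightarrow> sets m = sets punctured_borel"
  by (simp add: Mp_def)

lemma Mp_sets_iff: "m \<in> Mp \<Longrightarrow> A \<in> sets m \<longleftrightarrow> A \<in> sets borel \<and> 0 \<notin> A"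
  by (simp add: Mp_sets sets_punctured_borel)

lemma Mp_space: "m \<in> Mp \<Longrightarrow> space m = - {0}"
  using sets_eq_imp_space_eq[OF Mp_sets] space_punctured_borel by metis

lemma Mp_emeasure_cases:
  assumes "m \<in> Mp" "A \<in> sets m"
  obtains "emeasure m A = \<infinity>" | n :: nat where "emeasure m A = of_nat n"
  using assms unfolding Mp_def by blast

lemma Mp_finite:
  assumes "m \<in> Mp" "A \<in> sets borel" "A \<in> R0"
  shows "emeasure m A < \<infinity>"
  using assms R0_0_notin[OF assms(3)] by (auto simp: Mp_def sets_punctured_borel)

text \<open>
  The values of a counting measure leave a gap between 0 and 1; all facts about atoms below rest
  on it.
\<close>

lemma Mp_ge_1:
  assumes "m \<in> Mp" "emeasure m A > 0"
  shows "emeasure m A \<ge> 1"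
proof -
  have "A \<in> sets m" using assms(2) emeasure_notin_sets by fastforce
  with assms(1) show ?thesis
  proof (cases rule: Mp_emeasure_cases)
    case (2 n)
    with assms(2) have "n \<ge> 1" by (cases n) auto
    then have "of_nat 1 \<le> (of_nat n :: ennreal)" by (rule of_nat_mono)
    with 2 show ?thesis by simp
  qed simp
qed

text \<open>
  Lindelof's theorem gives a point \<open>x\<close> all of whose neighbourhoods carry mass in the
  given set, as otherwise countably many null sets would cover it. Integrality bounds these masses
  from below by 1, and on a part of the set with finite mass this bound survives in the limit of
  balls shrinking to \<open>x\<close>.
\<close>

lemma Mp_positive_imp_atom:
  assumes m: "m \<in> Mp" and A: "A \<in> sets m" and pos: "emeasure m A > 0"
  shows "atoms m \<inter> A \<noteq> {}"
proof -
  have A': "A \<in> sets borel" "0 \<notin> A" using A by (simp_all add: Mp_sets_iff[OF m])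
  \<comment> \<open>Cutting away a ball around the origin makes the mass finite.\<close>
  define N where "N n = A \<inter> {x. 1 / Suc n \<le> norm x}" for n :: nat
  have N_borel: "N n \<in> sets borel" for n using A'(1) by (auto simp: N_def)
  have N: "N n \<in> sets m" for n using N_borel A'(2) by (simp add: Mp_sets_iff[OF m] N_def)
  have "A \<subseteq> (\<Union>n. N n)"
  proof
    fix x assume "x \<in> A"
    then have "norm x > 0" using A'(2) by auto
    then obtain n where "inverse (real (Suc n)) < norm x" using reals_Archimedean by blast
    then show "x \<in> (\<Union>n. N n)"
      using \<open>x \<in> A\<close> by (auto simp: N_def inverse_eq_divide intro!: exI[of _ n])
  qed
  have "\<exists>n. emeasure m (N n) > 0"
  proof (rule ccontr)
    assume "\<not> (\<exists>n. emeasure m (N n) > 0)"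
    then have "N n \<in> null_sets m" for n using N by (auto simp: not_gr_zero intro!: null_setsI)
    then have "(\<Union>n. N n) \<in> null_sets m" by (intro null_sets_UN) auto
    then have "A \<in> null_sets m" using A \<open>A \<subseteq> (\<Union>n. N n)\<close> by (rule null_sets_subset)
    with pos show False by auto
  qed
  then obtain n where n: "emeasure m (N n) > 0" by blast
  have "N n \<in> R0"
    unfolding R0_iff by (intro exI[of _ "1 / Suc n"]) (auto simp: N_def)
  then have fin: "emeasure m (N n) < \<infinity>" using Mp_finite[OF m N_borel] by blast
  have "\<exists>x\<in>N n. \<forall>U. open U \<longrightarrow> x \<in> U \<longrightarrow> emeasure m (U \<inter> N n) > 0"
  proof (rule ccontr)
    assume neg: "\<not> ?thesis"
    let ?F = "{U. open U \<and> emeasure m (U \<inter> N n) = 0}"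
    have cov: "N n \<subseteq> \<Union>?F"
    proof
      fix x assume "x \<in> N n"
      with neg obtain U where "open U" "x \<in> U" "\<not> emeasure m (U \<inter> N n) > 0" by blast
      then show "x \<in> \<Union>?F" by (auto simp: not_gr_zero)
    qed
    obtain F' where F': "F' \<subseteq> ?F" "countable F'" "\<Union>F' = \<Union>?F"
      using Lindelof[of ?F] by blast
    have "U \<inter> N n \<in> null_sets m" if "U \<in> F'" for U
    proof (rule null_setsI)
      show "emeasure m (U \<inter> N n) = 0" using F'(1) that by blast
      have "U \<in> sets borel" using F'(1) that by auto
      then show "U \<inter> N n \<in> sets m" using N_borel A'(2) by (simp add: Mp_sets_iff[OF m] N_def)
    qed
    then have "(\<Union>U\<in>F'. U \<inter> N n) \<in> null_sets m" using F'(2) by (intro null_sets_UN') auto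
    moreover have "(\<Union>U\<in>F'. U \<inter> N n) = N n" using cov F'(3) by blast
    ultimately show False using n by auto
  qed
  then obtain x where x: "x \<in> N n" "\<And>U. open U \<Longrightarrow> x \<in> U \<Longrightarrow> emeasure m (U \<inter> N n) > 0" by blast
  define B where "B k = ball x (1 / Suc k) \<inter> N n" for k :: nat
  have B: "B k \<in> sets m" for k
    using N_borel A'(2) by (simp add: Mp_sets_iff[OF m] B_def N_def)
  have "(INF k. emeasure m (B k)) = emeasure m (\<Inter>k. B k)"
  proof (rule INF_emeasure_decseq)
    show "range B \<subseteq> sets m" using B by blast
    show "decseq B"
      unfolding decseq_def B_def
    proof (intro allI impI Int_mono subset_ball order_refl)
      fix j k :: nat assume "j \<le> k"
      then show "1 / real (Suc k) \<le> 1 / real (Suc j)" by (intro frac_le) auto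
    qed
    show "emeasure m (B k) \<noteq> \<infinity>" for k
      using emeasure_mono[of "B k" "N n" m] N fin by (auto simp: B_def top_unique)
  qed
  moreover have "1 \<le> (INF k. emeasure m (B k))"
    unfolding B_def by (intro INF_greatest Mp_ge_1[OF m] x(2)) auto
  moreover have "(\<Inter>k. B k) = {x}"
  proof
    show "{x} \<subseteq> (\<Inter>k. B k)" using x(1) by (auto simp: B_def)
    show "(\<Inter>k. B k) \<subseteq> {x}"
    proof
      fix y assume y: "y \<in> (\<Inter>k. B k)"
      have "\<not> dist x y > 0"
      proof
        assume "dist x y > 0"
        then obtain k where "inverse (real (Suc k)) < dist x y" using reals_Archimedean by blast
        moreover have "dist x y < 1 / Suc k" using y by (auto simp: B_def)
        ultimately show False by (simp add: inverse_eq_divide)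
      qed
      then show "y \<in> {x}" by simp
    qed
  qed
  ultimately have "1 \<le> emeasure m {x}" by simp
  then have "0 < emeasure m {x}" by (rule less_le_trans[OF zero_less_one])
  moreover have "x \<in> A" using x(1) by (simp add: N_def)
  moreover from this have "x \<in> space m" using A'(2) by (auto simp: Mp_space[OF m])
  ultimately show ?thesis unfolding atoms_def by blast
qed

lemma zero_notin_atoms: "m \<in> Mp \<Longrightarrow> 0 \<notin> atoms m"
  by (simp add: atoms_def Mp_space)

lemma Mp_ge_1_iff:
  assumes "m \<in> Mp" "A \<in> sets m"
  shows "1 \<le> emeasure m A \<longleftrightarrow> atoms m \<inter> A \<noteq> {}"
proof
  assume "1 \<le> emeasure m A"
  then have "0 < emeasure m A" by (rule less_le_trans[OF zero_less_one])
  with assms show "atoms m \<inter> A \<noteq> {}" by (intro Mp_positive_imp_atom)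
next
  assume "atoms m \<inter> A \<noteq> {}"
  then obtain x where x: "x \<in> A" "0 < emeasure m {x}" by (auto simp: atoms_def)
  have "emeasure m {x} \<le> emeasure m A" using x(1) assms(2) by (intro emeasure_mono) auto
  with x(2) show "1 \<le> emeasure m A" by (intro Mp_ge_1[OF assms(1)]) (rule less_le_trans)
qed

text \<open>
  Null sets are recognised from the atoms alone, which turns statements about vanishing integrals
  into statements about atoms.
\<close>

lemma Mp_null_iff:
  assumes "m \<in> Mp" "A \<in> sets m"
  shows "emeasure m A = 0 \<longleftrightarrow> atoms m \<inter> A = {}"
  using Mp_ge_1_iff[OF assms] Mp_ge_1[OF assms(1), of A] by (metis not_gr_zero not_one_le_zero)

lemma finite_atoms_away:
  assumes m: "m \<in> Mp" and "\<delta> > 0"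
  shows "finite (atoms m \<inter> {x. \<delta> \<le> norm x})"
proof -
  let ?C = "{x. \<delta> \<le> norm x}"
  have C: "?C \<in> sets m" using \<open>\<delta> > 0\<close> by (simp add: Mp_sets_iff[OF m])
  have "emeasure m ?C < \<infinity>" using Mp_finite[OF m _ norm_ge_R0[OF \<open>\<delta> > 0\<close>]] by simp
  with C m obtain n :: nat where n: "emeasure m ?C = of_nat n"
    by (metis Mp_emeasure_cases less_irrefl)
  have "finite (atoms m \<inter> ?C) \<and> card (atoms m \<inter> ?C) \<le> n"
  proof (rule finite_if_finite_subsets_card_bdd)
    fix D assume D: "D \<subseteq> atoms m \<inter> ?C" "finite D"
    have D1: "1 \<le> emeasure m {x}" if "x \<in> D" for x
      using D(1) that Mp_ge_1[OF m, of "{x}"] by (auto simp: atoms_def)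
    have D0: "{x} \<in> sets m" if "x \<in> D" for x
      using D(1) that zero_notin_atoms[OF m] by (auto simp: Mp_sets_iff[OF m])
    have "of_nat (card D) = (\<Sum>x\<in>D. 1 :: ennreal)" by simp
    also have "\<dots> \<le> (\<Sum>x\<in>D. emeasure m {x})" by (intro sum_mono D1)
    also have "\<dots> = emeasure m D"
      using D0 D(2) by (intro emeasure_eq_sum_singleton[symmetric])
    also have "\<dots> \<le> of_nat n" using D(1) C n emeasure_mono[of D ?C m] by auto
    finally show "card D \<le> n" by simp
  qed
  then show ?thesis by blast
qed

text \<open>
  Atoms are locally finite away from the origin, so they accumulate at most there.
\<close>

lemma closure_atoms_subset:
  assumes m: "m \<in> Mp"
  shows "closure (atoms m) \<subseteq> insert 0 (atoms m)"
proof
  fix x assume x: "x \<in> closure (atoms m)"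
  show "x \<in> insert 0 (atoms m)"
  proof (cases "x = 0")
    case False
    let ?D = "(atoms m \<inter> {y. norm x / 2 \<le> norm y}) \<union> cball 0 (norm x / 2)"
    have "closed ?D"
      using False by (intro closed_Un closed_cball finite_imp_closed finite_atoms_away[OF m]) simp
    moreover have "atoms m \<subseteq> ?D" by auto
    ultimately have "x \<in> ?D" using x closure_minimal by blast
    then show ?thesis using False by auto
  qed simp
qed

lemma compact_closure_atoms:
  assumes m: "m \<in> Mp"
  shows "compact (closure (atoms m))"
proof -
  have "atoms m \<subseteq> (atoms m \<inter> {x. 1 \<le> norm x}) \<union> cball 0 1" by auto
  moreover have "bounded ((atoms m \<inter> {x. 1 \<le> norm x}) \<union> cball 0 1)"
    using finite_atoms_away[OF m, of 1] by (simp add: finite_imp_bounded)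
  ultimately show ?thesis using bounded_subset compact_closure by blast
qed

lemma topspace_vague_topology: "topspace vague_topology = Mp"
proof -
  have "m \<in> \<Union>{{m \<in> Mp. (\<integral>x. f x \<partial>m) \<in> U} | f U. vague_test_fun f \<and> open U}" if "m \<in> Mp" for m :: "'a measure"
  proof (rule UnionI)
    have "vague_test_fun (\<lambda>x::'a. 0)" by (auto simp: vague_test_fun_def R0_iff bounded_iff intro: exI[of _ 1])
    then show "{m \<in> (Mp :: 'a measure set). (\<integral>x. (0::real) \<partial>m) \<in> UNIV} \<in>
        {{m \<in> Mp. (\<integral>x. f x \<partial>m) \<in> U} | f U. vague_test_fun f \<and> open U}" 
      by (intro CollectI exI[where x="\<lambda>x::'a. 0::real"]) (auto intro!: exI[where x="UNIV :: real set"])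
  qed (use that in simp)
  then show ?thesis unfolding vague_topology_def topology_generated_by_topspace by blast
qed

lemma openin_vague_integral:
  assumes "vague_test_fun f" "open U"
  shows "openin vague_topology {m \<in> Mp. (\<integral>x. f x \<partial>m) \<in> U}"
  unfolding vague_topology_def by (rule topology_generated_by_Basis) (use assms in blast)

lemma continuous_map_vague_integral:
  assumes "vague_test_fun f"
  shows "continuous_map vague_topology euclideanreal (\<lambda>m. \<integral>x. f x \<partial>m)"
  using openin_vague_integral[OF assms] by (simp add: continuous_map topspace_vague_topology)

text \<open>
  The source of all vague test functions below. Vanishing on a ball around the origin makes the
  support admissible.
\<close>

lemma vague_test_fun_Urysohn:
  fixes C S :: "'a::euclidean_space set"
  assumes "closed C" "closed S" "C \<inter> S = {}" and \<delta>: "\<delta> > 0" "cball 0 \<delta> \<subseteq> S"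
  obtains h :: "'a \<Rightarrow> real" where "vague_test_fun h" "\<And>x. 0 \<le> h x" "\<And>x. h x \<le> 1"
    "\<And>x. x \<in> C \<Longrightarrow> h x = 1" "\<And>x. x \<in> S \<Longrightarrow> h x = 0"
proof -
  obtain h :: "'a \<Rightarrow> real" where h: "continuous_on UNIV h" "\<And>x. h x \<in> closed_segment 0 1"
    "\<And>x. x \<in> S \<Longrightarrow> h x = 0" "\<And>x. x \<in> C \<Longrightarrow> h x = 1"
    using Urysohn[OF assms(2,1), of 0 "1::real"] assms(3) by auto
  have h01: "0 \<le> h x" "h x \<le> 1" for x using h(2)[of x] by (auto simp: closed_segment_eq_real_ivl)
  have "closed {x::'a. \<delta> \<le> norm x}" by (intro closed_Collect_le continuous_intros)
  moreover have "\<delta> \<le> norm x" if "h x \<noteq> 0" for x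
    using that h(3)[of x] \<delta>(2) by (force simp: subset_iff)
  ultimately have "closure {x. x \<noteq> 0 \<and> h x \<noteq> 0} \<subseteq> {x. \<delta> \<le> norm x}"
    by (intro closure_minimal) auto
  then have "vague_test_fun h"
    unfolding vague_test_fun_def
  proof (intro conjI)
    show "bounded (h ` (- {0}))" using h01 by (auto simp: bounded_iff intro!: exI[of _ 1])
    assume "closure {x. x \<noteq> 0 \<and> h x \<noteq> 0} \<subseteq> {x. \<delta> \<le> norm x}"
    then show "closure {x. x \<noteq> 0 \<and> h x \<noteq> 0} \<in> R0" using \<delta>(1) unfolding R0_iff by blast
  qed (use h(1) continuous_on_subset in blast)
  then show thesis using h01 h(4,3) by (rule that[of h])
qed

lemma vague_test_fun_measurable:
  assumes "vague_test_fun f" "m \<in> Mp"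
  shows "f \<in> borel_measurable m"
  using assms borel_measurable_continuous_on_restrict[of "- {0}" f]
  by (simp add: vague_test_fun_def measurable_cong_sets[OF Mp_sets refl] punctured_borel_def)

lemma vague_test_fun_integrable:
  assumes f: "vague_test_fun f" and m: "m \<in> Mp"
  shows "integrable m f"
proof -
  obtain \<delta> where \<delta>: "\<delta> > 0" "\<And>x. x \<in> closure {x. x \<noteq> 0 \<and> f x \<noteq> 0} \<Longrightarrow> \<delta> \<le> norm x"
    using f unfolding vague_test_fun_def R0_iff by blast
  obtain b where b: "\<And>x. x \<noteq> 0 \<Longrightarrow> \<bar>f x\<bar> \<le> b"
    using f unfolding vague_test_fun_def bounded_iff by auto
  let ?C = "{x. \<delta> \<le> norm x}"
  show ?thesis
  proof (rule Bochner_Integration.integrable_bound)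
    have "?C \<in> sets m" using \<delta>(1) by (simp add: Mp_sets_iff[OF m])
    moreover have "emeasure m ?C < \<infinity>" using Mp_finite[OF m _ norm_ge_R0[OF \<delta>(1)]] by simp
    ultimately show "integrable m (\<lambda>x. b * indicator ?C x)" by simp
    show "AE x in m. norm (f x) \<le> norm (b * indicator ?C x)"
    proof (intro AE_I2)
      fix x assume "x \<in> space m"
      then have "x \<noteq> 0" by (simp add: Mp_space[OF m])
      moreover have "\<delta> \<le> norm x" if "f x \<noteq> 0"
        using \<delta>(2)[of x] closure_subset[of "{x. x \<noteq> 0 \<and> f x \<noteq> 0}"] \<open>x \<noteq> 0\<close> that by blast
      ultimately show "norm (f x) \<le> norm (b * indicator ?C x)"
        using b[of x] by (auto simp: indicator_def)
    qed
  qed (rule vague_test_fun_measurable[OF f m])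
qed

lemma integral_nonzero_imp_atom:
  assumes f: "vague_test_fun f" and m: "m \<in> Mp" and nz: "(\<integral>x. f x \<partial>m) \<noteq> 0"
  shows "\<exists>x\<in>atoms m. f x \<noteq> 0"
proof (rule ccontr)
  assume neg: "\<not> ?thesis"
  have "{x \<in> space m. f x \<noteq> 0} \<in> sets m"
    using vague_test_fun_measurable[OF f m] by measurable
  moreover from Mp_null_iff[OF m this] have "emeasure m {x \<in> space m. f x \<noteq> 0} = 0"
    using neg by auto
  ultimately have "AE x in m. f x = 0" by (auto intro: AE_I')
  then have "(\<integral>x. f x \<partial>m) = 0" by (rule integral_eq_zero_AE)
  with nz show False by simp
qed

lemma one_le_integral_if_atom:
  assumes f: "vague_test_fun f" and f0: "\<And>x. 0 \<le> f x" and m: "m \<in> Mp"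
    and x: "x \<in> atoms m" "f x = 1"
  shows "1 \<le> (\<integral>x. f x \<partial>m)"
proof -
  have x0: "x \<noteq> 0" using x zero_notin_atoms[OF m] by auto
  then have xs: "{x} \<in> sets m" by (simp add: Mp_sets_iff[OF m])
  have fin: "emeasure m {x} < \<infinity>" using x0 by (intro Mp_finite[OF m]) (auto simp: R0_iff intro!: exI[of _ "norm x"])
  have int: "integrable m (indicator {x} :: _ \<Rightarrow> real)" using xs fin by simp
  have "1 \<le> emeasure m {x}" using x(1) by (auto simp: Mp_ge_1_iff[OF m xs])
  then have "1 \<le> measure m {x}" using fin by (simp add: emeasure_eq_ennreal_measure)
  also have "measure m {x} = (\<integral>y. indicator {x} y \<partial>m)" using xs fin by simp
  also have "\<dots> \<le> (\<integral>y. f y \<partial>m)"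
    using f0 x(2) by (intro integral_mono int vague_test_fun_integrable[OF f m]) (auto simp: indicator_def)
  finally show ?thesis .
qed

text \<open>
  A bump at an atom \<open>x\<close> in \<open>G\<close>, supported in \<open>G\<close> and away
  from the origin, has integral at least 1, and a measure for which its integral is positive has
  an atom in \<open>G\<close>.
\<close>

lemma openin_vague_hit:
  assumes "open G"
  shows "openin vague_topology {m \<in> Mp. atoms m \<inter> G \<noteq> {}}"
proof (subst openin_subopen, intro ballI)
  fix m0 assume "m0 \<in> {m \<in> Mp. atoms m \<inter> G \<noteq> {}}"
  then obtain x where m0: "m0 \<in> Mp" and x: "x \<in> atoms m0" "x \<in> G" by blast
  have x0: "x \<noteq> 0" using x zero_notin_atoms[OF m0] by auto
  define S where "S = - G \<union> cball 0 (norm x / 2)"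
  have "closed S" unfolding S_def using \<open>open G\<close> by (intro closed_Un closed_cball) auto
  moreover have "{x} \<inter> S = {}" "cball 0 (norm x / 2) \<subseteq> S" "norm x / 2 > 0"
    using x x0 by (auto simp: S_def)
  ultimately obtain h where h: "vague_test_fun h" "\<And>x. 0 \<le> h x" "\<And>y. y \<in> {x} \<Longrightarrow> h y = 1" "\<And>x. x \<in> S \<Longrightarrow> h x = 0"
    using vague_test_fun_Urysohn[of "{x}" S "norm x / 2"] by (metis closed_singleton)
  let ?V = "{m \<in> Mp. (\<integral>x. h x \<partial>m) \<in> {0<..}}"
  have "openin vague_topology ?V" by (rule openin_vague_integral[OF h(1)]) simp
  moreover have "m0 \<in> ?V" using one_le_integral_if_atom[OF h(1,2) m0 x(1)] h(3) m0 by force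
  moreover have "?V \<subseteq> {m \<in> Mp. atoms m \<inter> G \<noteq> {}}"
  proof
    fix m assume "m \<in> ?V"
    then have m: "m \<in> Mp" "(\<integral>x. h x \<partial>m) \<noteq> 0" by auto
    from integral_nonzero_imp_atom[OF h(1) this] obtain y where "y \<in> atoms m" "h y \<noteq> 0" by blast
    moreover from this have "y \<in> G" using h(4)[of y] by (auto simp: S_def)
    ultimately show "m \<in> {m \<in> Mp. atoms m \<inter> G \<noteq> {}}" using m by auto
  qed
  ultimately show "\<exists>T. openin vague_topology T \<and> m0 \<in> T \<and> T \<subseteq> {m \<in> Mp. atoms m \<inter> G \<noteq> {}}" by blast
qed

text \<open>
  A function that is 1 on \<open>C\<close> and vanishes at all atoms has integral 0, whereas a
  single atom in \<open>C\<close> would already make it at least 1.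
\<close>

lemma openin_vague_miss:
  assumes "closed C" "C \<in> R0"
  shows "openin vague_topology {m \<in> Mp. atoms m \<inter> C = {}}"
proof (subst openin_subopen, intro ballI)
  fix m0 assume "m0 \<in> {m \<in> Mp. atoms m \<inter> C = {}}"
  then have m0: "m0 \<in> Mp" and dj: "atoms m0 \<inter> C = {}" by auto
  obtain \<delta> where \<delta>: "\<delta> > 0" "\<And>x. x \<in> C \<Longrightarrow> \<delta> \<le> norm x" using assms(2) R0_iff by blast
  \<comment> \<open>The atoms close to the origin are absorbed in a ball, so that S is closed.\<close>
  define S where "S = (atoms m0 \<inter> {x. \<delta>/2 \<le> norm x}) \<union> cball 0 (\<delta>/2)"
  have "closed S" unfolding S_def
    using \<delta>(1) by (intro closed_Un closed_cball finite_imp_closed finite_atoms_away[OF m0]) simp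
  moreover have "C \<inter> S = {}" using dj \<delta> by (force simp: S_def)
  moreover have "cball 0 (\<delta>/2) \<subseteq> S" "\<delta>/2 > 0" using \<delta>(1) by (auto simp: S_def)
  ultimately obtain h where h: "vague_test_fun h" "\<And>x. 0 \<le> h x" "\<And>x. x \<in> C \<Longrightarrow> h x = 1" "\<And>x. x \<in> S \<Longrightarrow> h x = 0"
    using vague_test_fun_Urysohn[of C S "\<delta>/2"] assms(1) by metis
  let ?V = "{m \<in> Mp. (\<integral>x. h x \<partial>m) \<in> {..<1}}"
  have "openin vague_topology ?V" by (rule openin_vague_integral[OF h(1)]) simp
  moreover have "m0 \<in> ?V"
  proof -
    have "atoms m0 \<subseteq> S" by (auto simp: S_def)
    then have "(\<integral>x. h x \<partial>m0) = 0" using integral_nonzero_imp_atom[OF h(1) m0] h(4) by blast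
    then show ?thesis using m0 by simp
  qed
  moreover have "?V \<subseteq> {m \<in> Mp. atoms m \<inter> C = {}}"
    using one_le_integral_if_atom[OF h(1,2)] h(3) by fastforce
  ultimately show "\<exists>T. openin vague_topology T \<and> m0 \<in> T \<and> T \<subseteq> {m \<in> Mp. atoms m \<inter> C = {}}" by blast
qed

section \<open>Cutoff functions for the ideal of point measures\<close>

lemma topspace_MpR_top: "topspace MpR_top = Mp \<times> UNIV"
  by (simp add: MpR_top_def topspace_vague_topology)

lemma openin_MpR_Times:
  "openin vague_topology A \<Longrightarrow> open B \<Longrightarrow> openin MpR_top (A \<times> B)"
  by (simp add: MpR_top_def openin_prod_Times_iff)

lemma Mp1R_mass_on: "A \<in> sets borel \<Longrightarrow> A \<in> R0 \<Longrightarrow> {m \<in> Mp. 1 \<le> emeasure m A} \<times> UNIV \<in> Mp1R"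
  unfolding Mp1R_def Mp1_def by blast

lemma Mp1R_subset: "B \<in> Mp1R \<Longrightarrow> A \<subseteq> B \<Longrightarrow> A \<in> Mp1R"
  unfolding Mp1R_def by blast

lemma Mp1RE:
  assumes "B \<in> Mp1R"
  obtains A where "A \<in> sets borel" "A \<in> R0" "\<And>m r. (m, r) \<in> B \<Longrightarrow> m \<in> Mp \<and> atoms m \<inter> A \<noteq> {}"
proof -
  obtain D A where D: "B \<subseteq> D \<times> UNIV" "D \<subseteq> Mp" "A \<in> sets borel" "A \<in> R0" "\<forall>m\<in>D. emeasure m A \<ge> 1"
    using assms unfolding Mp1R_def Mp1_def by blast
  have "m \<in> Mp \<and> atoms m \<inter> A \<noteq> {}" if "(m, r) \<in> B" for m r
  proof -
    have m: "m \<in> D" "m \<in> Mp" using that D by auto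
    moreover have "A \<in> sets m" using D R0_0_notin by (simp add: Mp_sets_iff[OF m(2)])
    ultimately show ?thesis using Mp_ge_1_iff D(5) by blast
  qed
  with D(3,4) show thesis by (rule that)
qed

text \<open>
  If all measures in \<open>B\<close> have an atom of norm at least \<open>\<delta>\<close>, take
  \<open>h\<close> equal to 1 outside the \<open>\<delta>\<close>-ball and 0 on the
  \<open>\<delta>/2\<close>-ball. Then the integral of \<open>h\<close> is at least 1 on
  \<open>B\<close>, and wherever it is at least 1/2 there is an atom of norm at least
  \<open>\<delta>/2\<close>. The cutoff interpolates linearly between these two levels.
\<close>

lemma ideal_cutoffs_Mp1R: "ideal_cutoffs MpR_top (Mp1R :: ('a::euclidean_space measure \<times> ennreal) set set)"
  unfolding ideal_cutoffs_def
proof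
  fix B :: "('a measure \<times> ennreal) set" assume "B \<in> Mp1R"
  then obtain A where A: "A \<in> R0" "\<And>m r. (m, r) \<in> B \<Longrightarrow> m \<in> Mp \<and> atoms m \<inter> A \<noteq> {}"
    by (rule Mp1RE) blast
  from A(1) obtain \<delta> where \<delta>: "\<delta> > 0" "\<And>x. x \<in> A \<Longrightarrow> \<delta> \<le> norm x" unfolding R0_iff by blast
  have "closed {x::'a. \<delta> \<le> norm x}" by (intro closed_Collect_le continuous_intros)
  moreover have "{x::'a. \<delta> \<le> norm x} \<inter> cball 0 (\<delta>/2) = {}" using \<delta>(1) by auto
  moreover have "\<delta>/2 > 0" using \<delta>(1) by simp
  ultimately obtain h :: "'a \<Rightarrow> real" where h: "vague_test_fun h" "\<And>x. 0 \<le> h x"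
    "\<And>x. x \<in> {x. \<delta> \<le> norm x} \<Longrightarrow> h x = 1" "\<And>x. x \<in> cball 0 (\<delta>/2) \<Longrightarrow> h x = 0"
    by (rule vague_test_fun_Urysohn[of "{x::'a. \<delta> \<le> norm x}" "cball 0 (\<delta>/2)" "\<delta>/2", OF _ closed_cball _ _ order_refl]) blast
  let ?I = "\<lambda>p :: 'a measure \<times> ennreal. \<integral>x. h x \<partial>fst p"
  let ?c = "\<lambda>p. max 0 (min 1 (2 * ?I p - 1))"
  have I: "continuous_map MpR_top euclideanreal ?I"
    using continuous_map_compose[OF continuous_map_fst continuous_map_vague_integral[OF h(1)]]
    by (simp add: MpR_top_def o_def)
  then have "continuous_map MpR_top euclideanreal ?c"
    by (intro continuous_map_real_max continuous_map_real_min continuous_map_diff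
        continuous_map_real_mult continuous_map_canonical_const)
  moreover have "\<forall>p. 0 \<le> ?c p \<and> ?c p \<le> 1" by auto
  moreover have "\<forall>p\<in>B. ?c p = 1"
  proof
    fix p assume "p \<in> B"
    then obtain x where x: "fst p \<in> Mp" "x \<in> atoms (fst p)" "x \<in> A" using A(2)[of "fst p" "snd p"] by auto
    then have "1 \<le> ?I p" using \<delta>(2) h(3) by (intro one_le_integral_if_atom[OF h(1,2)]) auto
    then show "?c p = 1" by simp
  qed
  moreover have "MpR_top closure_of {p \<in> topspace MpR_top. ?c p \<noteq> 0} \<in> Mp1R"
  proof (rule Mp1R_subset)
    let ?Z = "{p \<in> topspace MpR_top. ?I p \<in> {1/2..}}"
    have "closedin MpR_top ?Z" by (rule closedin_continuous_map_preimage[OF I]) simp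
    then show "MpR_top closure_of {p \<in> topspace MpR_top. ?c p \<noteq> 0} \<subseteq> ?Z"
      by (intro closure_of_minimal) auto
    let ?A = "{x::'a. \<delta>/2 \<le> norm x}"
    show "?Z \<in> Mp1R"
    proof (rule Mp1R_subset)
      show "{m \<in> Mp. 1 \<le> emeasure m ?A} \<times> (UNIV :: ennreal set) \<in> Mp1R"
        using \<delta>(1) by (intro Mp1R_mass_on norm_ge_R0) auto
      show "?Z \<subseteq> {m \<in> Mp. 1 \<le> emeasure m ?A} \<times> (UNIV :: ennreal set)"
      proof
        fix p assume "p \<in> ?Z"
        then have m: "fst p \<in> Mp" and "?I p \<noteq> 0" by (auto simp: topspace_MpR_top)
        then obtain x where "x \<in> atoms (fst p)" "h x \<noteq> 0" using integral_nonzero_imp_atom[OF h(1)] by blast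
        moreover from this have "x \<in> ?A" using h(4)[of x] by force
        moreover have "?A \<in> sets (fst p)" using \<delta>(1) by (simp add: Mp_sets_iff[OF m])
        ultimately have "1 \<le> emeasure (fst p) ?A" using Mp_ge_1_iff[OF m] by blast
        with m show "p \<in> {m \<in> Mp. 1 \<le> emeasure m ?A} \<times> (UNIV :: ennreal set)" by (cases p) simp
      qed
    qed
  qed
  ultimately show "\<exists>c. continuous_map MpR_top euclideanreal c \<and> (\<forall>x. 0 \<le> c x \<and> c x \<le> 1) \<and>
     (\<forall>x\<in>B. c x = 1) \<and> MpR_top closure_of {x \<in> topspace MpR_top. c x \<noteq> 0} \<in> Mp1R" by blast
qed

lemma Mp1R_cover:
  "\<Union>Mp1R \<subseteq> (\<Union>n::nat. {m \<in> Mp. 1 \<le> emeasure m {x. 1 / Suc n \<le> norm x}} \<times> UNIV)"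
proof
  fix p assume "p \<in> \<Union>Mp1R"
  then obtain B where B: "B \<in> Mp1R" "p \<in> B" by blast
  obtain m r where p: "p = (m, r)" by (cases p)
  from B(1) obtain A where "\<And>m r. (m, r) \<in> B \<Longrightarrow> m \<in> Mp \<and> atoms m \<inter> A \<noteq> {}" by (rule Mp1RE) blast
  with B(2) p obtain x where m: "m \<in> Mp" and x: "x \<in> atoms m" by blast
  then have "norm x > 0" using zero_notin_atoms[OF m] by auto
  then obtain n where "inverse (real (Suc n)) < norm x" using reals_Archimedean by blast
  then have "x \<in> {x. 1 / Suc n \<le> norm x}" by (simp add: inverse_eq_divide)
  moreover have "{x. 1 / Suc n \<le> norm x} \<in> sets m" by (simp add: Mp_sets_iff[OF m])
  ultimately have "1 \<le> emeasure m {x. 1 / Suc n \<le> norm x}" using Mp_ge_1_iff[OF m] x by blast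
  then show "p \<in> (\<Union>n::nat. {m \<in> Mp. 1 \<le> emeasure m {x. 1 / Suc n \<le> norm x}} \<times> UNIV)"
    using m p by blast
qed

section \<open>The support map\<close>

lemma atoms_zero_measure [simp]: "atoms zero_measure = {}"
  by (simp add: atoms_def zero_measure_def)

lemma zero_measure_in_Mp: "zero_measure \<in> Mp"
  by (auto simp: Mp_def zero_measure_def intro: exI[of _ "0::nat"])

lemma atoms_eq_empty_iff:
  assumes "m \<in> Mp"
  shows "atoms m = {} \<longleftrightarrow> m = zero_measure"
proof
  assume "atoms m = {}"
  then have "emeasure m A = 0" if "A \<in> sets m" for A using Mp_null_iff[OF assms that] by simp
  then show "m = zero_measure"
    by (intro measure_eqI) (simp_all add: zero_measure_def Mp_sets[OF assms])
qed simp

lemma dist0_less_iff: "dist0 m < a \<longleftrightarrow> (\<exists>x\<in>atoms m. ennreal (norm x) < a)"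
  by (simp add: dist0_def INF_less_iff)

lemma dist0_le: "x \<in> atoms m \<Longrightarrow> dist0 m \<le> ennreal (norm x)"
  unfolding dist0_def by (rule INF_lower)

lemma dist0_eq_top_iff: "dist0 m = \<infinity> \<longleftrightarrow> atoms m = {}"
proof
  assume "dist0 m = \<infinity>"
  then show "atoms m = {}" using dist0_le[of _ m] by (auto simp: top_unique)
qed (simp add: dist0_def)

text \<open>
  The point \<open>(0, \<infinity>)\<close> is no exception, since the zero measure is the only
  point measure whose distance from the origin is infinite.
\<close>

lemma mem_M'_iff:
  fixes m :: "'a::euclidean_space measure"
  shows "(m, r) \<in> M' \<longleftrightarrow> m \<in> Mp \<and> (r = 0 \<or> r = dist0 m)"
proof -
  have "dist0 (zero_measure :: 'a measure) = \<infinity>" by (simp add: dist0_def)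
  moreover have "m = zero_measure" if "m \<in> Mp" "dist0 m = \<infinity>"
    using atoms_eq_empty_iff[OF that(1)] that(2) unfolding dist0_eq_top_iff by blast
  ultimately show ?thesis
    using zero_measure_in_Mp by (cases "r = \<infinity>") (auto simp: M'_def less_top)
qed

lemma psi_eq_closure: "psi (m, r) = closure (atoms m) \<union> (if r = 0 then {0} else {})"
  by (auto simp: psi_def not_gr_zero)

text \<open>
  If \<open>dist0 m = 0\<close>, then atoms accumulate at the origin, so adding it to the closure
  changes nothing. This holds for arbitrary measures, hence the two random sets agree also outside
  the sample space, where the values of \<open>\<eta>\<close> need not be point measures.
\<close>

lemma psi_dist0: "psi (m, dist0 m) = closure (atoms m)"
proof (cases "dist0 m = 0")
  case True
  have "\<exists>x\<in>atoms m. dist x 0 < e" if "e > 0" for e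
    using dist0_less_iff[of m "ennreal e"] True that by (auto simp: ennreal_less_iff)
  then have "0 \<in> closure (atoms m)" by (simp add: closure_approachable)
  then show ?thesis by (auto simp: psi_eq_closure)
qed (simp add: psi_eq_closure)

text \<open>
  A positive \<open>r\<close> is a lower bound for the norms of the atoms, so that the closure
  adds nothing.
\<close>

lemma psi_eq_atoms:
  assumes "(m, r) \<in> M'"
  shows "psi (m, r) = atoms m \<union> (if r = 0 then {0} else {})"
proof -
  have m: "m \<in> Mp" using assms by (simp add: mem_M'_iff)
  have cl: "atoms m \<subseteq> closure (atoms m)" "closure (atoms m) \<subseteq> insert 0 (atoms m)"
    using closure_subset closure_atoms_subset[OF m] by auto
  show ?thesis
  proof (cases "r = 0")
    case True
    then show ?thesis using cl by (auto simp: psi_eq_closure)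
  next
    case False
    then have r: "r = dist0 m" using assms by (simp add: mem_M'_iff)
    have "atoms m \<subseteq> {x. r \<le> ennreal (norm x)}" using dist0_le[of _ m] r by auto
    then have "closure (atoms m) \<subseteq> {x. r \<le> ennreal (norm x)}"
      using closed_norm_ge by (rule closure_minimal)
    then have "0 \<notin> closure (atoms m)" using False by auto
    then show ?thesis using cl False by (auto simp: psi_eq_closure)
  qed
qed

lemma compact_psi: "p \<in> M' \<Longrightarrow> compact (psi p)"
proof (cases p)
  case (Pair m r)
  assume "p \<in> M'"
  then have "compact (closure (atoms m))" using Pair by (intro compact_closure_atoms) (simp add: mem_M'_iff)
  then have "compact (closure (atoms m) \<union> (if r = 0 then {0} else {}))" by (intro compact_Un) auto
  then show ?thesis unfolding Pair psi_eq_closure .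
qed

text \<open>
  The distance from the origin is only upper semicontinuous: \<open>dist0 m < a\<close> is a hit
  condition, but atoms may appear near the origin in the limit. This is why pairs with \<open>r =
  0\<close> belong to the closure; a positive \<open>r\<close> strictly below \<open>dist0
  m\<close> is excluded by an annulus without atoms.
\<close>

lemma closedin_M': "closedin MpR_top M'"
  unfolding closedin_def
proof
  show "M' \<subseteq> topspace MpR_top" by (auto simp: topspace_MpR_top mem_M'_iff)
  show "openin MpR_top (topspace MpR_top - M')"
  proof (subst openin_subopen, intro ballI)
    fix p assume "p \<in> topspace MpR_top - M'"
    then obtain m0 r0 where p: "p = (m0, r0)" "m0 \<in> Mp" "r0 \<noteq> 0" "r0 \<noteq> dist0 m0"
      by (cases p) (auto simp: topspace_MpR_top mem_M'_iff)
    show "\<exists>T. openin MpR_top T \<and> p \<in> T \<and> T \<subseteq> topspace MpR_top - M'"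
    proof (cases "dist0 m0 < r0")
      case True
      then obtain a where a: "dist0 m0 < a" "a < r0" using dense by blast
      let ?G = "{x. ennreal (norm x) < a}"
      let ?V = "{m \<in> Mp. atoms m \<inter> ?G \<noteq> {}} \<times> {a<..}"
      have "open ?G" by (intro open_Collect_less continuous_intros continuous_on_ennreal)
      then have "openin MpR_top ?V" by (intro openin_MpR_Times openin_vague_hit) auto
      moreover have "p \<in> ?V" using p a by (auto simp: dist0_less_iff)
      moreover have "?V \<subseteq> topspace MpR_top - M'"
      proof
        fix q assume q: "q \<in> ?V"
        then obtain m r x where q': "q = (m, r)" "m \<in> Mp" "a < r" "x \<in> atoms m" "ennreal (norm x) < a" by auto
        then have "dist0 m < a" using dist0_less_iff by blast
        with q'(3) have "r \<noteq> dist0 m" "r \<noteq> 0" by auto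
        with q' show "q \<in> topspace MpR_top - M'" by (simp add: topspace_MpR_top mem_M'_iff)
      qed
      ultimately show ?thesis by blast
    next
      case False
      with p(4) have "r0 < dist0 m0" by simp
      then obtain a where a: "r0 < a" "a < dist0 m0" using dense by blast
      obtain \<delta> where \<delta>: "0 < \<delta>" "\<delta> < r0" using p(3) dense[of 0 r0] by (meson not_gr_zero)
      \<comment> \<open>The annulus excludes a measure whose distance from the origin lies between the two radii.\<close>
      let ?C = "{x. \<delta> \<le> ennreal (norm x)} \<inter> {x. ennreal (norm x) \<le> a}"
      let ?V = "{m \<in> Mp. atoms m \<inter> ?C = {}} \<times> {\<delta><..<a}"
      have "closed ?C"
        by (intro closed_Int closed_norm_ge closed_Collect_le continuous_intros continuous_on_ennreal)
      moreover have "?C \<in> R0" using norm_ge_ennreal_R0[OF \<delta>(1)] unfolding R0_iff by blast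
      ultimately have "openin MpR_top ?V" by (intro openin_MpR_Times openin_vague_miss) auto
      moreover have "p \<in> ?V" using p a \<delta> dist0_le[of _ m0] by fastforce
      moreover have "?V \<subseteq> topspace MpR_top - M'"
      proof
        fix q assume "q \<in> ?V"
        then obtain m r where q: "q = (m, r)" "m \<in> Mp" "\<delta> < r" "r < a" "atoms m \<inter> ?C = {}" by auto
        have "r \<noteq> dist0 m"
        proof
          assume r: "r = dist0 m"
          with q(4) obtain x where x: "x \<in> atoms m" "ennreal (norm x) < a" by (auto simp: dist0_less_iff)
          then have "\<delta> < ennreal (norm x)" using q(3) r dist0_le[of x m] by (auto intro: less_le_trans)
          then show False using q(5) x by auto
        qed
        moreover have "r \<noteq> 0" using q(3) by auto
        ultimately show "q \<in> topspace MpR_top - M'" using q by (simp add: topspace_MpR_top mem_M'_iff)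
      qed
      ultimately show ?thesis by blast
    qed
  qed
qed

lemma topspace_M': "topspace (subtopology MpR_top M') = M'"
  using closedin_subset[OF closedin_M'] by auto

text \<open>
  Hits and misses that do not involve the origin only concern the atoms. When \<open>G\<close>
  contains the origin, a small \<open>r\<close> forces a hit. When \<open>C\<close> contains the
  origin, a miss means \<open>r > 0\<close>, and then a lower bound \<open>\<delta>\<close> for
  \<open>r\<close> reduces the condition to the part of \<open>C\<close> outside the
  \<open>\<delta>\<close>-ball.
\<close>

lemma continuous_map_psi: "continuous_map (subtopology MpR_top M') Kd_top (psi :: 'a::euclidean_space measure \<times> ennreal \<Rightarrow> _)"
proof (rule continuous_map_Kd_top_hit_miss)
  fix p :: "'a measure \<times> ennreal" assume "p \<in> topspace (subtopology MpR_top M')"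
  then show "compact (psi p)"
    unfolding topspace_M' by (rule compact_psi)
next
  fix G :: "'a set" assume G: "open G"
  have "\<exists>W. openin MpR_top W \<and> {p \<in> M'. psi p \<inter> G \<noteq> {}} = W \<inter> M'"
  proof (cases "0 \<in> G")
    case False
    let ?W = "{m \<in> Mp. atoms m \<inter> G \<noteq> {}} \<times> (UNIV :: ennreal set)"
    have "openin MpR_top ?W" using G by (intro openin_MpR_Times openin_vague_hit) auto
    moreover have "{p \<in> M'. psi p \<inter> G \<noteq> {}} = ?W \<inter> M'"
      using False by (auto simp: psi_eq_atoms mem_M'_iff split: if_splits)
    ultimately show ?thesis by blast
  next
    case True
    then obtain e where e: "e > 0" "ball 0 e \<subseteq> G" using G open_contains_ball by blast
    let ?W = "{m \<in> Mp. atoms m \<inter> G \<noteq> {}} \<times> (UNIV :: ennreal set) \<union> Mp \<times> {..<ennreal e}"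
    have "openin vague_topology (Mp :: 'a measure set)"
      using openin_topspace[of vague_topology] by (simp add: topspace_vague_topology)
    then have "openin MpR_top ?W"
      using G by (intro openin_Un openin_MpR_Times openin_vague_hit) auto
    moreover have "psi (m, r) \<inter> G \<noteq> {} \<longleftrightarrow> (m, r) \<in> ?W" if "(m, r) \<in> M'" for m r
    proof
      assume "psi (m, r) \<inter> G \<noteq> {}"
      then show "(m, r) \<in> ?W" using that e(1) by (auto simp: psi_eq_atoms mem_M'_iff split: if_splits)
    next
      assume "(m, r) \<in> ?W"
      moreover have "psi (m, r) \<inter> G \<noteq> {}" if "r < ennreal e"
      proof (cases "r = 0")
        case False
        then have "dist0 m < ennreal e" using \<open>(m, r) \<in> M'\<close> that by (simp add: mem_M'_iff)
        then obtain x where "x \<in> atoms m" "ennreal (norm x) < ennreal e" by (auto simp: dist0_less_iff)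
        moreover from this have "x \<in> G" using e by (auto simp: ennreal_less_iff subset_iff)
        ultimately show ?thesis using \<open>(m, r) \<in> M'\<close> by (auto simp: psi_eq_atoms)
      qed (use True \<open>(m, r) \<in> M'\<close> in \<open>simp add: psi_eq_atoms\<close>)
      ultimately show "psi (m, r) \<inter> G \<noteq> {}" using that by (auto simp: psi_eq_atoms)
    qed
    then have "{p \<in> M'. psi p \<inter> G \<noteq> {}} = ?W \<inter> M'" by auto
    ultimately show ?thesis by blast
  qed
  then show "openin (subtopology MpR_top M') {p \<in> topspace (subtopology MpR_top M'). psi p \<inter> G \<noteq> {}}"
    by (simp only: openin_subtopology topspace_M')
next
  fix C :: "'a set" assume C: "closed C"
  have "\<exists>W. openin MpR_top W \<and> {p \<in> M'. psi p \<inter> C = {}} = W \<inter> M'"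
  proof (cases "0 \<in> C")
    case False
    let ?W = "{m \<in> Mp. atoms m \<inter> C = {}} \<times> (UNIV :: ennreal set)"
    have "openin MpR_top ?W"
      using C False by (intro openin_MpR_Times openin_vague_miss closed_imp_R0) auto
    moreover have "{p \<in> M'. psi p \<inter> C = {}} = ?W \<inter> M'"
      using False by (auto simp: psi_eq_atoms mem_M'_iff split: if_splits)
    ultimately show ?thesis by blast
  next
    case True
    let ?C = "\<lambda>\<delta>. C \<inter> {x. \<delta> \<le> ennreal (norm x)}"
    let ?W = "\<Union>\<delta>\<in>{0<..}. {m \<in> Mp. atoms m \<inter> ?C \<delta> = {}} \<times> {\<delta><..}"
    have "openin MpR_top ({m \<in> Mp. atoms m \<inter> ?C \<delta> = {}} \<times> {\<delta><..})" if "\<delta> > 0" for \<delta>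
    proof -
      have "closed (?C \<delta>)" using C closed_norm_ge by (rule closed_Int)
      moreover have "?C \<delta> \<in> R0" using norm_ge_ennreal_R0[OF that] unfolding R0_iff by blast
      ultimately show ?thesis by (intro openin_MpR_Times openin_vague_miss) auto
    qed
    then have "openin MpR_top ?W" by (intro openin_Union) auto
    moreover have "psi (m, r) \<inter> C = {} \<longleftrightarrow> (m, r) \<in> ?W" if "(m, r) \<in> M'" for m r
    proof
      assume dj: "psi (m, r) \<inter> C = {}"
      then have "r \<noteq> 0" using that True by (auto simp: psi_eq_atoms)
      then obtain \<delta> where "0 < \<delta>" "\<delta> < r" using dense[of 0 r] by (meson not_gr_zero)
      then show "(m, r) \<in> ?W" using dj that by (auto simp: psi_eq_atoms mem_M'_iff)
    next
      assume "(m, r) \<in> ?W"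
      then obtain \<delta> where \<delta>: "0 < \<delta>" "\<delta> < r" "atoms m \<inter> ?C \<delta> = {}" by auto
      then have "r \<noteq> 0" by auto
      with that have r: "r = dist0 m" by (simp add: mem_M'_iff)
      have "\<delta> \<le> ennreal (norm x)" if "x \<in> atoms m" for x
        using dist0_le[OF that] \<delta>(2) r by auto
      then have "atoms m \<inter> C = {}" using \<delta>(3) by blast
      then show "psi (m, r) \<inter> C = {}" using that \<open>r \<noteq> 0\<close> by (simp add: psi_eq_atoms)
    qed
    then have "{p \<in> M'. psi p \<inter> C = {}} = ?W \<inter> M'" by auto
    ultimately show ?thesis by blast
  qed
  then show "openin (subtopology MpR_top M') {p \<in> topspace (subtopology MpR_top M'). psi p \<inter> C = {}}"
    by (simp only: openin_subtopology topspace_M')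
qed

lemma dilate_measurable:
  assumes "m \<in> Mp" "t > 0"
  shows "(\<lambda>x. t *\<^sub>R x) \<in> m \<rightarrow>\<^sub>M punctured_borel"
proof -
  have "(\<lambda>x. t *\<^sub>R x) \<in> restrict_space borel (- {0}) \<rightarrow>\<^sub>M (borel :: 'a measure)"
    by (intro measurable_restrict_space1) simp
  then have "(\<lambda>x. t *\<^sub>R x) \<in> restrict_space borel (- {0}) \<rightarrow>\<^sub>M restrict_space (borel :: 'a measure) (- {0})"
    using assms(2) by (intro measurable_restrict_space2) (auto simp: space_restrict_space)
  then show ?thesis
    by (simp add: measurable_cong_sets[OF Mp_sets[OF assms(1)] refl] punctured_borel_def)
qed

lemma emeasure_dilate_measure:
  assumes "m \<in> Mp" "t > 0" "A \<in> sets punctured_borel"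
  shows "emeasure (dilate_measure t m) A = emeasure m ((\<lambda>x. t *\<^sub>R x) -` A \<inter> space m)"
  unfolding dilate_measure_def by (rule emeasure_distr[OF dilate_measurable[OF assms(1,2)] assms(3)])

lemma dilate_measure_in_Mp:
  assumes m: "m \<in> Mp" and t: "t > 0"
  shows "dilate_measure t m \<in> Mp"
proof -
  have pre: "(\<lambda>x. t *\<^sub>R x) -` A \<inter> space m \<in> sets m" if "A \<in> sets punctured_borel" for A
    using measurable_sets[OF dilate_measurable[OF m t] that] .
  have "emeasure (dilate_measure t m) A = \<infinity> \<or> (\<exists>n::nat. emeasure (dilate_measure t m) A = of_nat n)"
    if "A \<in> sets punctured_borel" for A
    unfolding emeasure_dilate_measure[OF m t that] using m pre[OF that] unfolding Mp_def by blast
  moreover have "emeasure (dilate_measure t m) A < \<infinity>" if A: "A \<in> sets punctured_borel" "A \<in> R0" for A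
  proof -
    obtain \<delta> where \<delta>: "\<delta> > 0" "\<And>x. x \<in> A \<Longrightarrow> \<delta> \<le> norm x" using A(2) R0_iff by blast
    have "\<delta> / t \<le> norm x" if "t *\<^sub>R x \<in> A" for x
      using \<delta>(2)[OF that] t by (simp add: field_simps)
    then have "(\<lambda>x. t *\<^sub>R x) -` A \<inter> space m \<in> R0"
      unfolding R0_iff using \<delta>(1) t by (intro exI[of _ "\<delta> / t"]) auto
    then show ?thesis
      unfolding emeasure_dilate_measure[OF m t A(1)] using m pre[OF A(1)] unfolding Mp_def by blast
  qed
  ultimately show ?thesis by (simp add: Mp_def) (simp add: dilate_measure_def)
qed

lemma atoms_dilate_measure:
  assumes m: "m \<in> Mp" and t: "t > 0"
  shows "atoms (dilate_measure t m) = (\<lambda>x. t *\<^sub>R x) ` atoms m"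
proof -
  have sp: "space (dilate_measure t m) = - {0}" by (simp add: dilate_measure_def space_punctured_borel)
  have "emeasure (dilate_measure t m) {t *\<^sub>R x} = emeasure m {x}" if "x \<noteq> 0" for x
  proof -
    have "(\<lambda>x. t *\<^sub>R x) -` {t *\<^sub>R x} \<inter> space m = {x}"
      using that t by (auto simp: Mp_space[OF m])
    then show ?thesis using emeasure_dilate_measure[OF m t, of "{t *\<^sub>R x}"] that t
      by (simp add: sets_punctured_borel)
  qed
  note em = this
  show ?thesis
  proof (intro equalityI subsetI)
    fix y assume "y \<in> atoms (dilate_measure t m)"
    then have y: "y \<noteq> 0" "emeasure (dilate_measure t m) {y} > 0" by (auto simp: atoms_def sp)
    define x where "x = inverse t *\<^sub>R y"
    have x: "y = t *\<^sub>R x" "x \<noteq> 0" using t y(1) by (auto simp: x_def)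
    then show "y \<in> (\<lambda>x. t *\<^sub>R x) ` atoms m"
      using y(2) em[OF x(2)] by (auto simp: atoms_def Mp_space[OF m])
  next
    fix y assume "y \<in> (\<lambda>x. t *\<^sub>R x) ` atoms m"
    then obtain x where "y = t *\<^sub>R x" "x \<noteq> 0" "emeasure m {x} > 0" by (auto simp: atoms_def Mp_space[OF m])
    then show "y \<in> atoms (dilate_measure t m)" using em[of x] t by (simp add: atoms_def sp)
  qed
qed

text \<open>
  One inequality, applied to \<open>t\<close> and to its inverse, gives both.
\<close>

lemma dist0_dilate_measure:
  assumes m: "m \<in> Mp" and t: "t > 0"
  shows "dist0 (dilate_measure t m) = ennreal t * dist0 m"
proof -
  have le: "ennreal t * dist0 m \<le> dist0 (dilate_measure t m)" if "m \<in> Mp" "t > 0"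
    for m :: "'a measure" and t :: real
  proof -
    have "ennreal t * dist0 m \<le> ennreal (norm (t *\<^sub>R x))" if "x \<in> atoms m" for x
    proof -
      have "ennreal t * dist0 m \<le> ennreal t * ennreal (norm x)"
        using dist0_le[OF that] by (intro mult_left_mono) auto
      then show ?thesis using \<open>t > 0\<close> by (simp add: ennreal_mult)
    qed
    then show ?thesis
      unfolding dist0_def[of "dilate_measure t m"] atoms_dilate_measure[OF that] by (auto intro!: INF_greatest)
  qed
  show ?thesis
  proof (rule antisym)
    show "ennreal t * dist0 m \<le> dist0 (dilate_measure t m)" by (rule le[OF m t])
    have atoms: "atoms (dilate_measure (inverse t) (dilate_measure t m)) = atoms m"
      using t by (simp add: atoms_dilate_measure dilate_measure_in_Mp m image_image)
    have "ennreal (inverse t) * dist0 (dilate_measure t m) \<le> dist0 m"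
      using le[OF dilate_measure_in_Mp[OF m t], of "inverse t"] t
      by (simp add: dist0_def atoms)
    then have "ennreal t * (ennreal (inverse t) * dist0 (dilate_measure t m)) \<le> ennreal t * dist0 m"
      by (intro mult_left_mono) auto
    moreover have "ennreal t * ennreal (inverse t) = 1" using t by (simp flip: ennreal_mult)
    ultimately show "dist0 (dilate_measure t m) \<le> ennreal t * dist0 m"
      by (simp flip: mult.assoc)
  qed
qed

lemma dilate_MpR_M': "t > 0 \<Longrightarrow> p \<in> M' \<Longrightarrow> dilate_MpR t p \<in> M'"
  by (cases p) (auto simp: dilate_MpR_def mem_M'_iff dilate_measure_in_Mp dist0_dilate_measure)

lemma psi_dilate_MpR:
  assumes t: "t > 0" and p: "p \<in> M'"
  shows "psi (dilate_MpR t p) = dilate_set t (psi p)"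
proof -
  obtain m r where mr: "p = (m, r)" by (cases p)
  have m: "m \<in> Mp" using p mr by (simp add: mem_M'_iff)
  have "ennreal t * r = 0 \<longleftrightarrow> r = 0" using t by simp
  moreover have "(dilate_measure t m, ennreal t * r) \<in> M'"
    using dilate_MpR_M'[OF t p] by (simp add: mr dilate_MpR_def)
  ultimately show ?thesis
    using p by (simp add: mr dilate_MpR_def psi_eq_atoms atoms_dilate_measure[OF m t] dilate_set_def image_Un)
qed

lemma psi_pull_K0:
  assumes "\<A> \<in> K0"
  shows "{p \<in> M'. psi p \<in> \<A>} \<in> Mp1R"
proof -
  obtain \<delta> where \<delta>: "\<delta> > 0" "\<And>K. K \<in> \<A> \<Longrightarrow> \<exists>x\<in>K. \<delta> < ennreal (norm x)"
    using K0_imp_points_away_from_0[OF assms] by blast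
  let ?A = "{x. \<delta> \<le> ennreal (norm x)}"
  have A: "?A \<in> sets borel" "?A \<in> R0" using closed_norm_ge norm_ge_ennreal_R0[OF \<delta>(1)] by auto
  show ?thesis
  proof (rule Mp1R_subset[OF Mp1R_mass_on[OF A]])
    show "{p \<in> M'. psi p \<in> \<A>} \<subseteq> {m \<in> Mp. 1 \<le> emeasure m ?A} \<times> UNIV"
    proof
      fix p assume p: "p \<in> {p \<in> M'. psi p \<in> \<A>}"
      obtain m r where mr: "p = (m, r)" by (cases p)
      have m: "m \<in> Mp" using p mr by (simp add: mem_M'_iff)
      obtain x where x: "x \<in> psi p" "\<delta> < ennreal (norm x)" using p \<delta>(2) by blast
      then have "x \<noteq> 0" by auto
      with x p have "x \<in> atoms m" by (auto simp: mr psi_eq_atoms split: if_splits)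
      moreover have "?A \<in> sets m" using A R0_0_notin[OF A(2)] by (simp add: Mp_sets_iff[OF m])
      ultimately have "1 \<le> emeasure m ?A" using Mp_ge_1_iff[OF m, of ?A] x(2) by auto
      then show "p \<in> {m \<in> Mp. 1 \<le> emeasure m ?A} \<times> UNIV" using m mr by simp
    qed
  qed
qed

lemma psi_push_Mp1R:
  assumes p: "p \<in> M'" "p \<in> \<Union>Mp1R"
  shows "psi p \<in> \<Union>K0"
proof -
  obtain m r where mr: "p = (m, r)" by (cases p)
  obtain B where B: "B \<in> Mp1R" "p \<in> B" using p(2) by blast
  from B(1) obtain A where "\<And>m r. (m, r) \<in> B \<Longrightarrow> m \<in> Mp \<and> atoms m \<inter> A \<noteq> {}" by (rule Mp1RE) blast
  with B(2) mr obtain x where m: "m \<in> Mp" and x: "x \<in> atoms m" by blast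
  then have "norm x > 0" using zero_notin_atoms[OF m] by auto
  then obtain n where "inverse (real (Suc n)) < norm x" using reals_Archimedean by blast
  then have "1 / Suc n < norm x" by (simp add: inverse_eq_divide)
  moreover have "x \<in> psi p" "compact (psi p)"
    using x p(1) compact_psi[OF p(1)] by (auto simp: mr psi_eq_atoms)
  ultimately show ?thesis using K0_hit[of n] by blast
qed

theorem theorem4p7p11:
  fixes P :: "'w measure"
    and \<eta> :: "'w \<Rightarrow> 'a::euclidean_space measure"
    and g :: "real \<Rightarrow> real"
    and \<mu> :: "('a measure \<times> ennreal) measure"
  assumes "random_element P vague_topology \<eta>"
    and "RV P MpR_top dilate_MpR Mp1R g \<mu> (\<lambda>\<omega>. (\<eta> \<omega>, dist0 (\<eta> \<omega>)))"
  shows "RV P Kd_top dilate_set K0 g (psi_pushforward \<mu>) (\<lambda>\<omega>. closure (atoms (\<eta> \<omega>)))"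
proof -
  have "\<eta> \<omega> \<in> Mp" if "\<omega> \<in> space P" for \<omega>
    using assms(1) measurable_space[OF _ that, of \<eta> "borel_of vague_topology"]
    by (simp add: random_element_def topspace_vague_topology)
  then have "(\<eta> \<omega>, dist0 (\<eta> \<omega>)) \<in> M'" if "\<omega> \<in> space P" for \<omega>
    using that by (simp add: mem_M'_iff)
  moreover have "{m \<in> Mp. 1 \<le> emeasure m {x. 1 / Suc n \<le> norm x}} \<times> UNIV \<in> Mp1R" for n
    by (intro Mp1R_mass_on norm_ge_R0) auto
  moreover have "openin Kd_top {K. compact K \<and> K \<inter> {x::'a. 1 / Suc n < norm x} \<noteq> {}}" for n
    by (intro openin_Kd_top_hit open_Collect_less continuous_intros)
  ultimately have "RV P Kd_top dilate_set K0 g (distr (restrict_space \<mu> M') (borel_of Kd_top) psi)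
      (\<lambda>\<omega>. psi (\<eta> \<omega>, dist0 (\<eta> \<omega>)))"
    by (intro RV_continuous_image[OF assms(2) closedin_M' _ dilate_MpR_M' ideal_cutoffs_Mp1R _ Mp1R_cover
        metrizable_space_Kd_top scaling_on_Kd_top ideal_on_K0 _ K0_hit K0_cover
        continuous_map_psi psi_dilate_MpR psi_pull_K0 psi_push_Mp1R])
  then show ?thesis by (simp add: psi_pushforward_def psi_dist0)
qed

end
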